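(* Let $q$ be a unimodular complex number, and let $(V_1,V_2)$ and $(V_1',V_2')$ be two $q$-commutative pairs of isometries with BCL-1 $q$-tuples $(\mathcal F,\mathcal K_u;P,U,W_1,W_2)$ and $(\mathcal F',\mathcal K_u';P',U',W_1',W_2')$, respectively. Then $(V_1,V_2)$ and $(V_1',V_2')$ are (jointly) unitarily equivalent if and only if there exist unitary operators $\omega:\mathcal F\to\mathcal F'$ and $\omega_u:\mathcal K_u\to\mathcal K_u'$ such that $$\omega P=P'\omega,\quad \omega U=U'\omega,\quad \omega_uW_1=W_1'\omega_u,\quad \omega_uW_2=W_2'\omega_u.$$ The same statement remains true with BCL-2 $q$-tuples in place of BCL-1 $q$-tuples.
   Context: A pair $(A,B)$ of operators is $q$-commutative if $AB=qBA$. Two pairs $(A_1,A_2)$ and $(B_1,B_2)$ are (jointly) unitarily equivalent if a single unitary $\tau$ satisfies $\tau A_j=B_j\tau$, $j=1,2$. $H^2$ is the Hardy space of the unit disk, $M_z$ is multiplication by $z$ on $H^2$, and $(R_qf)(z)=f(qz)$ on $H^2$. $P^\perp=I-P$. A BCL-1 $q$-tuple of a $q$-commutative pair of isometries $(V_1,V_2)$ is a tuple $(\mathcal F,\mathcal K_u;P,U,W_1,W_2)$ consisting of Hilbert spaces $\mathcal F,\mathcal K_u$, an orthogonal projection $P$ and a unitary $U$ in $\mathcal B(\mathcal F)$, and a $q$-commutative pair $(W_1,W_2)$ of unitaries on $\mathcal K_u$, such that $(V_1,V_2)$ is jointly unitarily equivalent to the pair $$\left((R_q\otimes P^\perp U +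 M_zR_q\otimes P U)\oplus W_1,\ (R_{\overline q}\otimes U^*P+R_{\overline q}M_z\otimes U^*P^\perp)\oplus W_2\right)\ \text{ on }(H^2\otimes \mathcal F)\oplus\mathcal K_u.$$ A BCL-2 $q$-tuple of $(V_1,V_2)$ is a tuple $(\mathcal F_\dag,\mathcal K_{u\dag};P_\dag,U_\dag,W_{1\dag},W_{2\dag})$ of the same kind (Hilbert spaces, projection, unitary, $q$-commutative pair of unitaries) such that $(V_1,V_2)$ is jointly unitarily equivalent to $$\left((R_q\otimes U_\dag^*P_\dag^\perp + M_zR_q\otimes U_\dag^*P_\dag)\oplus W_{1\dag},\ (R_{\overline q}\otimes P_\dag U_\dag+R_{\overline q}M_z\otimes P_\dag^\perp U_\dag)\oplus W_{2\dag}\right)\ \text{ on }(H^2\otimes \mathcal F_\dag)\oplus\mathcal K_{u\dag}.$$ *)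

theory Defs
  imports "HOL-Analysis.Analysis"
begin

section \<open>Complex Hilbert spaces\<close>

text \<open>
  The inner product \<open>cinner\<close> is linear in its first argument. The underlying real Hilbert space
  carries the inner product \<open>Re (cinner x y)\<close>, so \<open>norm x\<close> is the usual \<open>sqrt (cinner x x)\<close>, and
  norms, limits and completeness are those of the library. Positive definiteness of \<open>cinner\<close>
  is inherited from \<open>inner\<close>.
\<close>

class complex_hilbert = real_inner + complete_space +
  fixes scaleC :: "complex \<Rightarrow> 'a \<Rightarrow> 'a"  (infixr \<open>*\<^sub>C\<close> 75)
    and cinner :: "'a \<Rightarrow> 'a \<Rightarrow> complex"
  assumes scaleC_add_right: "c *\<^sub>C (x + y) = c *\<^sub>C x + c *\<^sub>C y"
    and scaleC_add_left: "(c + d) *\<^sub>C x = c *\<^sub>C x + d *\<^sub>C x"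
    and scaleC_scaleC: "c *\<^sub>C d *\<^sub>C x = (c * d) *\<^sub>C x"
    and scaleR_scaleC: "r *\<^sub>R x = complex_of_real r *\<^sub>C x"
    and cinner_commute: "cinner x y = cnj (cinner y x)"
    and cinner_add_left: "cinner (x + y) z = cinner x z + cinner y z"
    and cinner_scaleC_left: "cinner (c *\<^sub>C x) y = c * cinner x y"
    and inner_cinner: "inner x y = Re (cinner x y)"

subclass (in complex_hilbert) banach
proof qed

lemma scaleC_one [simp]: "1 *\<^sub>C (x::'a::complex_hilbert) = x"
  using scaleR_scaleC[of 1 x] by simp

lemma scaleC_zero_left [simp]: "0 *\<^sub>C (x::'a::complex_hilbert) = 0"
  using scaleR_scaleC[of 0 x] by simp

lemma scaleC_zero_right [simp]: "c *\<^sub>C (0::'a::complex_hilbert) = 0"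
  using scaleC_add_right[of c "0::'a" 0] by simp

lemma scaleC_minus_right: "c *\<^sub>C (- x) = - (c *\<^sub>C (x::'a::complex_hilbert))"
  using scaleC_add_right[of c x "- x"] by (simp add: eq_neg_iff_add_eq_0 add.commute)

lemma scaleC_diff_right: "c *\<^sub>C (x - y) = c *\<^sub>C x - c *\<^sub>C (y::'a::complex_hilbert)"
  using scaleC_add_right[of c x "- y"] by (simp add: scaleC_minus_right)

lemma scaleC_scaleR_commute: "c *\<^sub>C r *\<^sub>R x = r *\<^sub>R c *\<^sub>C (x::'a::complex_hilbert)"
  by (simp add: scaleR_scaleC scaleC_scaleC mult.commute)

lemma cinner_add_right: "cinner x (y + z) = cinner x y + cinner x (z::'a::complex_hilbert)"
  by (metis cinner_commute cinner_add_left complex_cnj_add)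

lemma cinner_scaleC_right: "cinner x (c *\<^sub>C y) = cnj c * cinner x (y::'a::complex_hilbert)"
  by (metis cinner_commute cinner_scaleC_left complex_cnj_mult)

lemma cinner_zero_left [simp]: "cinner 0 (y::'a::complex_hilbert) = 0"
  using cinner_add_left[of 0 0 y] by simp

lemma cinner_zero_right [simp]: "cinner (x::'a::complex_hilbert) 0 = 0"
  using cinner_add_right[of x 0 0] by simp

lemma cinner_minus_left: "cinner (- x) y = - cinner x (y::'a::complex_hilbert)"
  using cinner_add_left[of x "- x" y] by (simp add: eq_neg_iff_add_eq_0 add.commute)

lemma cinner_diff_left: "cinner (x - z) y = cinner x y - cinner z (y::'a::complex_hilbert)"
  using cinner_add_left[of x "- z" y] by (simp add: cinner_minus_left)

lemma cinner_diff_right: "cinner y (x - z) = cinner y x - cinner y (z::'a::complex_hilbert)"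
  by (metis cinner_commute cinner_diff_left complex_cnj_diff)

lemma cinner_sum_left: "cinner (sum f A) y = (\<Sum>i\<in>A. cinner (f i) (y::'a::complex_hilbert))"
  by (induction A rule: infinite_finite_induct) (auto simp: cinner_add_left)

lemma cinner_sum_right: "cinner y (sum f A) = (\<Sum>i\<in>A. cinner (y::'a::complex_hilbert) (f i))"
  by (induction A rule: infinite_finite_induct) (auto simp: cinner_add_right)

lemma scaleC_sum_right: "c *\<^sub>C sum f A = (\<Sum>i\<in>A. c *\<^sub>C (f i ::'a::complex_hilbert))"
  by (induction A rule: infinite_finite_induct) (auto simp: scaleC_add_right)

lemma cinner_self: "cinner x x = complex_of_real ((norm (x::'a::complex_hilbert))\<^sup>2)"
proof (rule complex_eqI)
  show "Re (cinner x x) = Re (complex_of_real ((norm x)\<^sup>2))"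
    by (simp add: power2_norm_eq_inner inner_cinner)
  have "Im (cinner x x) = - Im (cinner x x)"
    using arg_cong[OF cinner_commute[of x x], of Im] by simp
  then show "Im (cinner x x) = Im (complex_of_real ((norm x)\<^sup>2))"
    by simp
qed

lemma norm_scaleC: "norm (c *\<^sub>C x) = cmod c * norm (x::'a::complex_hilbert)"
proof -
  have "complex_of_real ((norm (c *\<^sub>C x))\<^sup>2) = c * cnj c * of_real ((norm x)\<^sup>2)"
    by (simp only: cinner_self[symmetric] cinner_scaleC_left cinner_scaleC_right) simp
  also have "\<dots> = complex_of_real ((cmod c * norm x)\<^sup>2)"
    by (simp add: complex_norm_square[symmetric] power_mult_distrib)
  finally have "(norm (c *\<^sub>C x))\<^sup>2 = (cmod c * norm x)\<^sup>2"
    using of_real_eq_iff by blast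
  then show ?thesis
    by (simp add: power2_eq_iff_nonneg)
qed

lemma cinner_Cauchy_Schwarz: "cmod (cinner x y) \<le> norm x * norm (y::'a::complex_hilbert)"
proof (cases "cinner x y = 0")
  case False
  define c where "c = cnj (cinner x y) / cmod (cinner x y)"
  have c: "cmod c = 1"
    using False by (simp add: c_def norm_divide)
  have "cinner (c *\<^sub>C x) y = cmod (cinner x y)"
    using False
    by (simp add: cinner_scaleC_left c_def complex_norm_square[symmetric] mult.commute[of "cnj _"]
        power2_eq_square)
  then have "cmod (cinner x y) = inner (c *\<^sub>C x) y"
    by (simp add: inner_cinner)
  also have "\<dots> \<le> norm (c *\<^sub>C x) * norm y"
    by (rule norm_cauchy_schwarz)
  finally show ?thesis
    by (simp add: norm_scaleC c)
qed simp

lemma bounded_linear_cinner_left: "bounded_linear (\<lambda>x. cinner x (y::'a::complex_hilbert))"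
proof (rule bounded_linear_intro[where K = "norm y"])
  show "cinner (r *\<^sub>R x) y = r *\<^sub>R cinner x y" for r and x :: 'a
    by (simp add: scaleR_scaleC cinner_scaleC_left scaleR_conv_of_real)
qed (auto simp: cinner_add_left cinner_Cauchy_Schwarz)

lemma bounded_linear_scaleC_right: "bounded_linear (\<lambda>x::'a::complex_hilbert. c *\<^sub>C x)"
  by (rule bounded_linear_intro[where K = "cmod c"])
     (auto simp: scaleC_add_right scaleC_scaleR_commute norm_scaleC mult.commute)

lemma bounded_linear_scaleC_left: "bounded_linear (\<lambda>c. c *\<^sub>C (x::'a::complex_hilbert))"
  by (rule bounded_linear_intro[where K = "norm x"])
     (auto simp: scaleC_add_left scaleR_conv_of_real scaleR_scaleC scaleC_scaleC norm_scaleC)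

lemma cinner_left_eqI:
  assumes "\<And>y. cinner x y = cinner (z::'a::complex_hilbert) y"
  shows "x = z"
proof -
  have "cinner (x - z) (x - z) = 0"
    using assms by (simp add: cinner_diff_left)
  then show ?thesis
    by (simp add: cinner_self)
qed

instantiation complex :: complex_hilbert
begin

definition scaleC_complex :: "complex \<Rightarrow> complex \<Rightarrow> complex"
  where "scaleC_complex c x = c * x"

definition cinner_complex :: "complex \<Rightarrow> complex \<Rightarrow> complex"
  where "cinner_complex x y = x * cnj y"

instance
  by standard
     (auto simp: scaleC_complex_def cinner_complex_def algebra_simps inner_complex_def
       scaleR_conv_of_real)

end

text \<open>The Cartesian product with the Hilbert space structure of the orthogonal direct sum.\<close>

instantiation prod :: (complex_hilbert, complex_hilbert) complex_hilbert
begin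

definition scaleC_prod :: "complex \<Rightarrow> 'a \<times> 'b \<Rightarrow> 'a \<times> 'b"
  where "scaleC_prod c x = (c *\<^sub>C fst x, c *\<^sub>C snd x)"

definition cinner_prod :: "'a \<times> 'b \<Rightarrow> 'a \<times> 'b \<Rightarrow> complex"
  where "cinner_prod x y = cinner (fst x) (fst y) + cinner (snd x) (snd y)"

instance
proof
  fix x y z :: "'a \<times> 'b" and c d :: complex and r :: real
  show "cinner x y = cnj (cinner y x)"
    unfolding cinner_prod_def by (metis cinner_commute complex_cnj_add)
  show "r *\<^sub>R x = complex_of_real r *\<^sub>C x"
    by (simp add: scaleC_prod_def scaleR_prod_def scaleR_scaleC)
qed (auto simp: scaleC_prod_def cinner_prod_def scaleC_add_right scaleC_add_left scaleC_scaleC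
      cinner_add_left cinner_scaleC_left inner_prod_def inner_cinner algebra_simps)

end


section \<open>Operators\<close>

definition bounded_clinear :: "('a::complex_hilbert \<Rightarrow> 'b::complex_hilbert) \<Rightarrow> bool"
  where "bounded_clinear T \<longleftrightarrow> bounded_linear T \<and> (\<forall>c x. T (c *\<^sub>C x) = c *\<^sub>C T x)"

definition isometry_op :: "('a::complex_hilbert \<Rightarrow> 'b::complex_hilbert) \<Rightarrow> bool"
  where "isometry_op V \<longleftrightarrow> bounded_clinear V \<and> (\<forall>x. norm (V x) = norm x)"

definition unitary_op :: "('a::complex_hilbert \<Rightarrow> 'b::complex_hilbert) \<Rightarrow> bool"
  where "unitary_op U \<longleftrightarrow> isometry_op U \<and> surj U"

definition adjoint_of ::
    "('a::complex_hilbert \<Rightarrow> 'b::complex_hilbert) \<Rightarrow> ('b \<Rightarrow> 'a) \<Rightarrow> bool"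
  where "adjoint_of T S \<longleftrightarrow> (\<forall>x y. cinner (T x) y = cinner x (S y))"

text \<open>
  Adjoints are unique (\<open>cadjoint_eqI\<close>); for unitaries, the only operators whose adjoint is taken
  below, existence is \<open>unitary_op_cadjoint\<close>.
\<close>

definition cadjoint ::
    "('a::complex_hilbert \<Rightarrow> 'b::complex_hilbert) \<Rightarrow> 'b \<Rightarrow> 'a"  (\<open>_\<^sup>\<star>\<close> [1000] 999)
  where "T\<^sup>\<star> = (THE S. adjoint_of T S)"

definition orthogonal_projection :: "('a::complex_hilbert \<Rightarrow> 'a) \<Rightarrow> bool"
  where "orthogonal_projection P \<longleftrightarrow> bounded_clinear P \<and> P \<circ> P = P \<and> adjoint_of P P"

definition compl_proj :: "('a::complex_hilbert \<Rightarrow> 'a) \<Rightarrow> 'a \<Rightarrow> 'a"  (\<open>_\<^sup>\<bottom>\<close> [1000] 999)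
  where "P\<^sup>\<bottom> = (\<lambda>x. x - P x)"

definition q_commutative ::
    "complex \<Rightarrow> ('a::complex_hilbert \<Rightarrow> 'a) \<Rightarrow> ('a \<Rightarrow> 'a) \<Rightarrow> bool"
  where "q_commutative q A B \<longleftrightarrow> (\<forall>x. A (B x) = q *\<^sub>C B (A x))"

definition jointly_unitarily_equivalent ::
    "('a::complex_hilbert \<Rightarrow> 'a) \<times> ('a \<Rightarrow> 'a) \<Rightarrow>
     ('b::complex_hilbert \<Rightarrow> 'b) \<times> ('b \<Rightarrow> 'b) \<Rightarrow> bool"
  where "jointly_unitarily_equivalent = (\<lambda>(A\<^sub>1, A\<^sub>2) (B\<^sub>1, B\<^sub>2).
    \<exists>\<tau>. unitary_op \<tau> \<and> \<tau> \<circ> A\<^sub>1 = B\<^sub>1 \<circ> \<tau> \<and> \<tau> \<circ> A\<^sub>2 = B\<^sub>2 \<circ> \<tau>)"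

definition op_plus :: "('a \<Rightarrow> 'b::complex_hilbert) \<Rightarrow> ('a \<Rightarrow> 'b) \<Rightarrow> 'a \<Rightarrow> 'b"  (infixl \<open>\<boxplus>\<close> 60)
  where "A \<boxplus> B = (\<lambda>x. A x + B x)"

definition op_dsum ::
    "('a \<Rightarrow> 'c) \<Rightarrow> ('b \<Rightarrow> 'd) \<Rightarrow> 'a \<times> 'b \<Rightarrow> 'c \<times> 'd"  (infixr \<open>\<oplus>\<^sub>H\<close> 55)
  where "A \<oplus>\<^sub>H B = map_prod A B"

lemma bounded_clinearI:
  assumes "\<And>x y. T (x + y) = T x + T y" "\<And>c x. T (c *\<^sub>C x) = c *\<^sub>C T x"
    and "\<And>x. norm (T x) \<le> norm x * K"
  shows "bounded_clinear T"
  unfolding bounded_clinear_def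
  using assms by (auto intro!: bounded_linear_intro[where K = K] simp: scaleR_scaleC)

lemma bounded_clinear_bounded_linear: "bounded_clinear T \<Longrightarrow> bounded_linear T"
  by (simp add: bounded_clinear_def)

lemma bounded_clinear_scaleC: "bounded_clinear T \<Longrightarrow> T (c *\<^sub>C x) = c *\<^sub>C T x"
  by (simp add: bounded_clinear_def)

lemma bounded_clinear_compose:
  "bounded_clinear S \<Longrightarrow> bounded_clinear T \<Longrightarrow> bounded_clinear (S \<circ> T)"
  by (auto simp: bounded_clinear_def comp_def bounded_linear_compose)

lemma cadjoint_eqI:
  assumes "adjoint_of T S"
  shows "T\<^sup>\<star> = S"
  unfolding cadjoint_def
proof (rule the_equality)
  show "adjoint_of T S"
    by fact
  fix S'
  assume S': "adjoint_of T S'"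
  have "S' y = S y" for y
    by (rule cinner_left_eqI)
       (metis S' assms adjoint_of_def cinner_commute)
  then show "S' = S" ..
qed

text \<open>Polarization: an isometry preserves \<open>cinner\<close>.\<close>

lemma isometry_op_cinner:
  assumes "isometry_op V"
  shows "cinner (V x) (V y) = cinner x y"
proof -
  have lin: "linear V" and sc: "\<And>c x. V (c *\<^sub>C x) = c *\<^sub>C V x"
    using assms
    by (auto simp: isometry_op_def bounded_clinear_def bounded_linear.linear)
  have *: "inner (V x) (V y) = inner x y" for x y
    using assms
    by (simp add: isometry_op_def dot_norm linear_add[OF lin, symmetric])
  have "Re (cinner (V x) (V y)) = Re (cinner x y)"
    using * by (simp add: inner_cinner)
  moreover have "Im (cinner (V x) (V y)) = Im (cinner x y)"
    using *[of x "\<i> *\<^sub>C y"] by (simp add: inner_cinner sc cinner_scaleC_right)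
  ultimately show ?thesis
    by (rule complex_eqI)
qed

lemma unitary_op_bij:
  assumes "unitary_op U"
  shows "bij U"
proof (rule bijI)
  have "linear U"
    using assms
    by (auto simp: unitary_op_def isometry_op_def bounded_clinear_def bounded_linear.linear)
  then show "inj U"
    using assms
    by (auto simp: linear_injective_0 unitary_op_def isometry_op_def) (metis norm_eq_zero)
  show "surj U"
    using assms by (simp add: unitary_op_def)
qed

lemma unitary_op_cadjoint:
  assumes "unitary_op U"
  shows "U\<^sup>\<star> = inv U" and "adjoint_of U (U\<^sup>\<star>)"
proof -
  have "adjoint_of U (inv U)"
    unfolding adjoint_of_def
    by (metis assms isometry_op_cinner surj_f_inv_f unitary_op_def)
  then show "U\<^sup>\<star> = inv U" and "adjoint_of U (U\<^sup>\<star>)"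
    by (simp_all add: cadjoint_eqI)
qed


section \<open>The Hardy space and its Hilbert space tensor product with a Hilbert space\<close>

text \<open>
  \<open>'a hardy\<close> is the space of all functions \<open>f(z) = (\<Sum>n. z^n a\<^sub>n)\<close> from the open unit disk to \<open>'a\<close>
  with \<open>(\<Sum>n. (norm a\<^sub>n)\<^sup>2) < \<infinity>\<close>; the functions are extended by zero outside the disk.
  \<open>complex hardy\<close> is the Hardy space itself. \<open>'a hardy\<close> is its Hilbert space tensor product with
  \<open>'a\<close>, with elementary tensors \<open>(f \<otimes>\<^sub>H x)(z) = f(z) x\<close>; the defining
  properties of a Hilbert space tensor product are established below as \<open>cinner_tensor\<close>,
  \<open>tensor_total\<close> and the bilinearity of \<open>\<otimes>\<^sub>H\<close>.
\<close>

definition l2seq :: "(nat \<Rightarrow> 'a::complex_hilbert) \<Rightarrow> bool"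
  where "l2seq a \<longleftrightarrow> summable (\<lambda>n. (norm (a n))\<^sup>2)"

definition power_series :: "(nat \<Rightarrow> 'a::complex_hilbert) \<Rightarrow> complex \<Rightarrow> 'a"
  where "power_series a z = (if cmod z < 1 then \<Sum>n. z ^ n *\<^sub>C a n else 0)"

lemma l2seq_0 [simp]: "l2seq (\<lambda>n. 0)"
  by (simp add: l2seq_def)

lemma l2seq_scaleC:
  assumes "l2seq a"
  shows "l2seq (\<lambda>n. c *\<^sub>C a n)"
  using assms by (auto simp: l2seq_def norm_scaleC power_mult_distrib intro: summable_mult)

lemma l2seq_add:
  assumes "l2seq a" "l2seq b"
  shows "l2seq (\<lambda>n. a n + b n)"
  unfolding l2seq_def
proof (rule summable_comparison_test'[where N = 0])
  show "summable (\<lambda>n. 2 * (norm (a n))\<^sup>2 + 2 * (norm (b n))\<^sup>2)"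
    using assms unfolding l2seq_def by (intro summable_add summable_mult)
  fix n
  have "(norm (a n + b n))\<^sup>2 \<le> (norm (a n) + norm (b n))\<^sup>2"
    by (simp add: norm_triangle_ineq)
  also have "\<dots> \<le> 2 * (norm (a n))\<^sup>2 + 2 * (norm (b n))\<^sup>2"
    using sum_squares_bound[of "norm (a n)" "norm (b n)"] by (simp add: power2_sum)
  finally show "norm ((norm (a n + b n))\<^sup>2) \<le> 2 * (norm (a n))\<^sup>2 + 2 * (norm (b n))\<^sup>2"
    by simp
qed

lemma l2seq_diff:
  assumes "l2seq a" "l2seq b"
  shows "l2seq (\<lambda>n. a n - b n)"
proof -
  have "(-1) *\<^sub>C b n = - b n" for n
    using scaleR_scaleC[of "-1" "b n"] by simp
  then show ?thesis
    using l2seq_add[OF assms(1) l2seq_scaleC[OF assms(2), of "-1"]] by simp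
qed

lemma l2seq_finite:
  assumes "\<And>n. n \<ge> N \<Longrightarrow> a n = 0"
  shows "l2seq a"
  unfolding l2seq_def by (rule summable_finite[of "{..<N}"]) (use assms in auto)

lemma l2seq_summable_cinner:
  assumes "l2seq a" "l2seq b"
  shows "summable (\<lambda>n. cinner (a n) (b n))"
proof (rule summable_comparison_test'[where N = 0])
  show "summable (\<lambda>n. (norm (a n))\<^sup>2 + (norm (b n))\<^sup>2)"
    using assms unfolding l2seq_def by (intro summable_add)
  fix n
  have "norm (cinner (a n) (b n)) \<le> norm (a n) * norm (b n)"
    by (rule cinner_Cauchy_Schwarz)
  also have "\<dots> \<le> (norm (a n))\<^sup>2 + (norm (b n))\<^sup>2"
    using sum_squares_bound[of "norm (a n)" "norm (b n)"]
      mult_nonneg_nonneg[of "norm (a n)" "norm (b n)"]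
    by (simp del: mult_nonneg_nonneg)
  finally show "norm (cinner (a n) (b n)) \<le> (norm (a n))\<^sup>2 + (norm (b n))\<^sup>2" .
qed

lemma l2seq_norm_le:
  assumes "l2seq a"
  shows "(norm (a n))\<^sup>2 \<le> (\<Sum>n. (norm (a n))\<^sup>2)"
  using sum_le_suminf[OF assms[unfolded l2seq_def], of "{n}"] by auto

lemma summable_power_series:
  assumes "l2seq a" "cmod z < 1"
  shows "summable (\<lambda>n. z ^ n *\<^sub>C a n)"
proof (rule summable_comparison_test'[where N = 0])
  define K where "K = sqrt (\<Sum>n. (norm (a n))\<^sup>2)"
  show "summable (\<lambda>n. cmod z ^ n * K)"
    using assms(2) by (intro summable_mult2 summable_geometric) auto
  fix n
  have "norm (a n) \<le> K"
    using l2seq_norm_le[OF assms(1), of n] by (simp add: K_def real_le_rsqrt)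
  then show "norm (z ^ n *\<^sub>C a n) \<le> cmod z ^ n * K"
    by (simp add: norm_scaleC norm_power mult_left_mono)
qed

lemma power_series_inj:
  fixes a b :: "nat \<Rightarrow> 'a::complex_hilbert"
  assumes a: "l2seq a" and b: "l2seq b" and eq: "power_series a = power_series b"
  shows "a = b"
proof -
  have *: "(\<lambda>n. cinner (c n) y * z ^ n) sums cinner (power_series c z) y"
    if "l2seq c" "cmod z < 1" for c :: "nat \<Rightarrow> 'a" and y z
    using bounded_linear.sums[OF bounded_linear_cinner_left[of y]
        summable_sums[OF summable_power_series[OF that]]]
    using that by (simp add: power_series_def cinner_scaleC_left mult.commute)
  have "cinner (a n) y = cinner (b n) y" for n y
  proof -
    define F where "F c = Abs_fps (\<lambda>n. cinner (c n) y)" for c :: "nat \<Rightarrow> 'a"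
    have rad: "fps_conv_radius (F c) > 0" if "l2seq c" for c
    proof -
      have "fps_conv_radius (F c) \<ge> norm (1/2::complex)"
        unfolding fps_conv_radius_def
        by (rule conv_radius_geI) (use sums_summable[OF *[OF that]] in \<open>simp add: F_def\<close>)
      moreover have "(0::ereal) < ereal (norm (1/2::complex))"
        by simp
      ultimately show ?thesis
        by (rule less_le_trans[rotated])
    qed
    have ev: "eval_fps (F c) z = cinner (power_series c z) y" if "l2seq c" "cmod z < 1" for c z
      using sums_unique[OF *[OF that]] by (simp add: eval_fps_def F_def)
    have "eventually (\<lambda>z. z \<in> ball 0 1) (nhds (0::complex))"
      by (rule eventually_nhds_in_open) auto
    then have "eventually (\<lambda>z. eval_fps (F a) z = eval_fps (F b) z) (nhds 0)"
      by eventually_elim (simp add: ev a b eq)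
    then have "F a = F b"
      using rad a b by (intro eval_fps_eqD) auto
    then show ?thesis
      by (metis F_def fps_nth_Abs_fps)
  qed
  then have "a n = b n" for n
    by (rule cinner_left_eqI)
  then show ?thesis ..
qed

typedef (overloaded) 'a hardy = "{power_series (a :: nat \<Rightarrow> 'a::complex_hilbert) |a. l2seq a}"
  morphisms hardy_fun Abs_hardy
  using l2seq_0 by blast

definition hardy_coeff :: "'a::complex_hilbert hardy \<Rightarrow> nat \<Rightarrow> 'a"
  where "hardy_coeff f = (THE a. l2seq a \<and> hardy_fun f = power_series a)"

lemma hardy_coeff_works: "l2seq (hardy_coeff f) \<and> hardy_fun f = power_series (hardy_coeff f)"
proof -
  have "\<exists>!a. l2seq a \<and> hardy_fun f = power_series a"
    using hardy_fun[of f] by (auto intro: power_series_inj)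
  from theI'[OF this] show ?thesis
    unfolding hardy_coeff_def .
qed

lemma l2seq_hardy_coeff [simp]: "l2seq (hardy_coeff f)"
  using hardy_coeff_works by blast

lemma hardy_fun_eq: "hardy_fun f = power_series (hardy_coeff f)"
  using hardy_coeff_works by blast

lemma hardy_fun_Abs [simp]: "l2seq a \<Longrightarrow> hardy_fun (Abs_hardy (power_series a)) = power_series a"
  by (rule Abs_hardy_inverse) auto

lemma hardy_coeff_Abs [simp]: "l2seq a \<Longrightarrow> hardy_coeff (Abs_hardy (power_series a)) = a"
  by (metis hardy_fun_Abs hardy_fun_eq l2seq_hardy_coeff power_series_inj)

lemma hardy_coeff_eqI:
  assumes "\<And>n. hardy_coeff f n = hardy_coeff g n"
  shows "f = g"
proof -
  have "hardy_coeff f = hardy_coeff g"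
    using assms ..
  then show ?thesis
    by (metis hardy_fun_eq hardy_fun_inject)
qed

lemma power_series_add:
  assumes "l2seq a" "l2seq b"
  shows "(\<lambda>z. power_series a z + power_series b z) = power_series (\<lambda>n. a n + b n)"
  using assms
  by (auto simp: power_series_def fun_eq_iff scaleC_add_right suminf_add summable_power_series)

lemma power_series_scaleC:
  assumes "l2seq a"
  shows "(\<lambda>z. c *\<^sub>C power_series a z) = power_series (\<lambda>n. c *\<^sub>C a n)"
proof
  fix z
  show "c *\<^sub>C power_series a z = power_series (\<lambda>n. c *\<^sub>C a n) z"
    using bounded_linear.suminf[OF bounded_linear_scaleC_right summable_power_series[OF assms], of z c]
    by (auto simp: power_series_def scaleC_scaleC mult.commute)
qed

lemma power_series_0: "(\<lambda>z. 0) = power_series (\<lambda>n. 0)"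
  by (auto simp: power_series_def)

instantiation hardy :: (complex_hilbert) real_inner
begin

definition zero_hardy :: "'a hardy"
  where "0 = Abs_hardy (\<lambda>z. 0)"

definition plus_hardy :: "'a hardy \<Rightarrow> 'a hardy \<Rightarrow> 'a hardy"
  where "f + g = Abs_hardy (\<lambda>z. hardy_fun f z + hardy_fun g z)"

definition scaleR_hardy :: "real \<Rightarrow> 'a hardy \<Rightarrow> 'a hardy"
  where "r *\<^sub>R f = Abs_hardy (\<lambda>z. complex_of_real r *\<^sub>C hardy_fun f z)"

definition uminus_hardy :: "'a hardy \<Rightarrow> 'a hardy"
  where "- f = (-1) *\<^sub>R f" for f :: "'a hardy"

definition minus_hardy :: "'a hardy \<Rightarrow> 'a hardy \<Rightarrow> 'a hardy"
  where "f - g = f + (- g)" for f g :: "'a hardy"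

definition inner_hardy :: "'a hardy \<Rightarrow> 'a hardy \<Rightarrow> real"
  where "inner f g = Re (\<Sum>n. cinner (hardy_coeff f n) (hardy_coeff g n))"

definition norm_hardy :: "'a hardy \<Rightarrow> real"
  where "norm f = sqrt (inner f f)" for f :: "'a hardy"

definition dist_hardy :: "'a hardy \<Rightarrow> 'a hardy \<Rightarrow> real"
  where "dist f g = norm (f - g)" for f g :: "'a hardy"

definition sgn_hardy :: "'a hardy \<Rightarrow> 'a hardy"
  where "sgn f = inverse (norm f) *\<^sub>R f" for f :: "'a hardy"

definition uniformity_hardy :: "('a hardy \<times> 'a hardy) filter"
  where "uniformity_hardy = (INF e\<in>{0<..}. principal {(x, y). dist x y < e})"

definition open_hardy :: "'a hardy set \<Rightarrow> bool"
  where "open_hardy U \<longleftrightarrow> (\<forall>x\<in>U. eventually (\<lambda>(x', y). x' = x \<longrightarrow> y \<in> U) uniformity)"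

lemma hardy_coeff_0 [simp]: "hardy_coeff 0 n = 0"
  by (simp add: zero_hardy_def power_series_0)

lemma hardy_coeff_add [simp]: "hardy_coeff (f + g) n = hardy_coeff f n + hardy_coeff g n"
  by (simp add: plus_hardy_def hardy_fun_eq power_series_add l2seq_add)

lemma hardy_coeff_scaleR [simp]: "hardy_coeff (r *\<^sub>R f) n = r *\<^sub>R hardy_coeff f n"
  by (simp add: scaleR_hardy_def hardy_fun_eq power_series_scaleC l2seq_scaleC scaleR_scaleC)

lemma hardy_coeff_uminus [simp]: "hardy_coeff (- f) n = - hardy_coeff f n"
  by (simp add: uminus_hardy_def)

lemma hardy_coeff_diff [simp]: "hardy_coeff (f - g) n = hardy_coeff f n - hardy_coeff g n"
  by (simp add: minus_hardy_def)

lemma inner_hardy_sums: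
  "(\<lambda>n. inner (hardy_coeff f n) (hardy_coeff g n)) sums inner f g"
  unfolding inner_hardy_def inner_cinner
  by (intro sums_Re summable_sums l2seq_summable_cinner) auto

instance
proof
  fix f g h :: "'a hardy" and r s :: real
  show "f + g + h = f + (g + h)" "f + g = g + f" "0 + f = f" "- f + f = 0" "f - g = f + - g"
    "r *\<^sub>R (f + g) = r *\<^sub>R f + r *\<^sub>R g" "(r + s) *\<^sub>R f = r *\<^sub>R f + s *\<^sub>R f"
    "r *\<^sub>R s *\<^sub>R f = (r * s) *\<^sub>R f" "1 *\<^sub>R f = f"
    by (rule hardy_coeff_eqI; simp add: algebra_simps)+
  show "sgn f = inverse (norm f) *\<^sub>R f"
    by (rule sgn_hardy_def)
  show "dist f g = norm (f - g)"
    by (rule dist_hardy_def)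
  show "uniformity = (INF e\<in>{0<..}. principal {(x, y :: 'a hardy). dist x y < e})"
    by (rule uniformity_hardy_def)
  show "open U \<longleftrightarrow> (\<forall>x\<in>U. eventually (\<lambda>(x', y). x' = x \<longrightarrow> y \<in> U) uniformity)"
    for U :: "'a hardy set"
    by (rule open_hardy_def)
  show "inner f g = inner g f"
    using inner_hardy_sums[of f g] inner_hardy_sums[of g f]
    by (simp add: inner_commute sums_unique2)
  show "inner (f + g) h = inner f h + inner g h"
    using inner_hardy_sums[of "f + g" h] sums_add[OF inner_hardy_sums[of f h] inner_hardy_sums[of g h]]
    by (simp add: inner_add_left sums_unique2)
  show "inner (r *\<^sub>R f) g = r * inner f g"
    using inner_hardy_sums[of "r *\<^sub>R f" g] sums_mult[OF inner_hardy_sums[of f g], of r]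
    by (simp add: sums_unique2)
  show "0 \<le> inner f f"
    by (rule sums_le[OF _ sums_zero inner_hardy_sums[of f f]]) simp
  show "inner f f = 0 \<longleftrightarrow> f = 0"
  proof
    assume "inner f f = 0"
    then have "(\<Sum>n. inner (hardy_coeff f n) (hardy_coeff f n)) = 0"
      using sums_unique[OF inner_hardy_sums[of f f]] by simp
    then have "inner (hardy_coeff f n) (hardy_coeff f n) = 0" for n
      using suminf_eq_zero_iff[OF sums_summable[OF inner_hardy_sums[of f f]] inner_ge_zero] by blast
    then show "f = 0"
      by (intro hardy_coeff_eqI) simp
  next
    assume "f = 0"
    then show "inner f f = 0"
      by (simp add: inner_hardy_def)
  qed
  show "norm f = sqrt (inner f f)"
    by (rule norm_hardy_def)
qed

end

lemma norm_hardy_sums: "(\<lambda>n. (norm (hardy_coeff f n))\<^sup>2) sums (norm f)\<^sup>2"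
  using inner_hardy_sums[of f f] by (simp add: power2_norm_eq_inner)

lemma norm_hardy_coeff_le: "norm (hardy_coeff f n) \<le> norm f"
proof -
  have "(norm (hardy_coeff f n))\<^sup>2 \<le> (norm f)\<^sup>2"
    using l2seq_norm_le[of "hardy_coeff f" n] sums_unique[OF norm_hardy_sums[of f]] by simp
  then show ?thesis
    by (simp add: power2_le_iff_abs_le)
qed

lemma sum_hardy_coeff_le: "(\<Sum>n<N. (norm (hardy_coeff f n))\<^sup>2) \<le> (norm f)\<^sup>2"
  using sum_le_suminf[OF sums_summable[OF norm_hardy_sums[of f]], of "{..<N}"]
    sums_unique[OF norm_hardy_sums[of f]] by simp

instance hardy :: (complex_hilbert) complete_space
proof
  fix X :: "nat \<Rightarrow> 'a hardy"
  assume X: "Cauchy X"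
  have "Cauchy (\<lambda>m. hardy_coeff (X m) n)" for n
  proof (rule CauchyI)
    fix e :: real
    assume "e > 0"
    with X obtain M where M: "\<And>m k. m \<ge> M \<Longrightarrow> k \<ge> M \<Longrightarrow> norm (X m - X k) < e"
      by (meson CauchyD)
    have "norm (hardy_coeff (X m) n - hardy_coeff (X k) n) < e" if "m \<ge> M" "k \<ge> M" for m k
      using M[OF that] norm_hardy_coeff_le[of "X m - X k" n] by simp
    then show "\<exists>M. \<forall>m\<ge>M. \<forall>k\<ge>M. norm (hardy_coeff (X m) n - hardy_coeff (X k) n) < e"
      by blast
  qed
  then have "\<exists>l. (\<lambda>m. hardy_coeff (X m) n) \<longlonglongrightarrow> l" for n
    by (meson Cauchy_convergent convergentD)
  then obtain a where a: "\<And>n. (\<lambda>m. hardy_coeff (X m) n) \<longlonglongrightarrow> a n"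
    by metis
  have bound: "(\<Sum>n<N. (norm (hardy_coeff (X m) n - a n))\<^sup>2) \<le> e\<^sup>2"
    if "\<And>k. k \<ge> M \<Longrightarrow> norm (X m - X k) \<le> e" for m e M N
  proof (rule LIMSEQ_le_const2)
    show "(\<lambda>k. \<Sum>n<N. (norm (hardy_coeff (X m) n - hardy_coeff (X k) n))\<^sup>2)
        \<longlonglongrightarrow> (\<Sum>n<N. (norm (hardy_coeff (X m) n - a n))\<^sup>2)"
      by (intro tendsto_intros a)
    have "(\<Sum>n<N. (norm (hardy_coeff (X m) n - hardy_coeff (X k) n))\<^sup>2) \<le> e\<^sup>2" if "k \<ge> M" for k
    proof -
      have "(\<Sum>n<N. (norm (hardy_coeff (X m) n - hardy_coeff (X k) n))\<^sup>2) \<le> (norm (X m - X k))\<^sup>2"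
        using sum_hardy_coeff_le[of "X m - X k" N] by simp
      also have "\<dots> \<le> e\<^sup>2"
        using \<open>\<And>k. k \<ge> M \<Longrightarrow> norm (X m - X k) \<le> e\<close>[OF that] by (simp add: power_mono)
      finally show ?thesis .
    qed
    then show "\<exists>K. \<forall>k\<ge>K. (\<Sum>n<N. (norm (hardy_coeff (X m) n - hardy_coeff (X k) n))\<^sup>2) \<le> e\<^sup>2"
      by blast
  qed
  have diff: "l2seq (\<lambda>n. hardy_coeff (X m) n - a n)"
    and diff_le: "(\<Sum>n. (norm (hardy_coeff (X m) n - a n))\<^sup>2) \<le> e\<^sup>2"
    if "\<And>k. k \<ge> M \<Longrightarrow> norm (X m - X k) \<le> e" for m e M
  proof -
    show 1: "l2seq (\<lambda>n. hardy_coeff (X m) n - a n)"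
      unfolding l2seq_def
      by (rule bounded_imp_summable[where B = "e\<^sup>2"])
         (use bound[where m = m and e = e and M = M, OF that, of "Suc _"] lessThan_Suc_atMost in auto)
    show "(\<Sum>n. (norm (hardy_coeff (X m) n - a n))\<^sup>2) \<le> e\<^sup>2"
      using 1 bound[where m = m and e = e and M = M, OF that]
      by (intro suminf_le_const) (auto simp: l2seq_def)
  qed
  have l2a: "l2seq a"
  proof -
    obtain M where M: "\<And>m k. m \<ge> M \<Longrightarrow> k \<ge> M \<Longrightarrow> norm (X m - X k) < 1"
      using X by (meson CauchyD zero_less_one)
    have "l2seq (\<lambda>n. hardy_coeff (X M) n - a n)"
      by (rule diff[where M = M and e = 1]) (use M[of M] in \<open>auto intro: less_imp_le\<close>)
    from l2seq_diff[OF l2seq_hardy_coeff[of "X M"] this] show ?thesis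
      by simp
  qed
  have "X \<longlonglongrightarrow> Abs_hardy (power_series a)"
  proof (rule LIMSEQ_I)
    fix e :: real
    assume "e > 0"
    then obtain M where M: "\<And>m k. m \<ge> M \<Longrightarrow> k \<ge> M \<Longrightarrow> norm (X m - X k) < e/2"
      using CauchyD[OF X, of "e/2"] by auto
    have "norm (X m - Abs_hardy (power_series a)) < e" if "m \<ge> M" for m
    proof -
      have "(norm (X m - Abs_hardy (power_series a)))\<^sup>2
          = (\<Sum>n. (norm (hardy_coeff (X m) n - a n))\<^sup>2)"
        using sums_unique[OF norm_hardy_sums[of "X m - Abs_hardy (power_series a)"]] l2a by simp
      also have "\<dots> \<le> (e/2)\<^sup>2"
        by (rule diff_le[where M = M]) (use M[OF that] in \<open>auto intro: less_imp_le\<close>)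
      finally have "norm (X m - Abs_hardy (power_series a)) \<le> e/2"
        using \<open>e > 0\<close> by (simp add: power2_le_iff_abs_le)
      then show ?thesis
        using \<open>e > 0\<close> by simp
    qed
    then show "\<exists>M. \<forall>m\<ge>M. norm (X m - Abs_hardy (power_series a)) < e"
      by blast
  qed
  then show "convergent X"
    by (rule convergentI)
qed

instantiation hardy :: (complex_hilbert) complex_hilbert
begin

definition scaleC_hardy :: "complex \<Rightarrow> 'a hardy \<Rightarrow> 'a hardy"
  where "c *\<^sub>C f = Abs_hardy (\<lambda>z. c *\<^sub>C hardy_fun f z)"

definition cinner_hardy :: "'a hardy \<Rightarrow> 'a hardy \<Rightarrow> complex"
  where "cinner f g = (\<Sum>n. cinner (hardy_coeff f n) (hardy_coeff g n))"

lemma hardy_coeff_scaleC [simp]: "hardy_coeff (c *\<^sub>C f) n = c *\<^sub>C hardy_coeff f n"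
  by (simp add: scaleC_hardy_def hardy_fun_eq power_series_scaleC l2seq_scaleC)

lemma cinner_hardy_sums:
  "(\<lambda>n. cinner (hardy_coeff f n) (hardy_coeff g n)) sums cinner f g"
  unfolding cinner_hardy_def by (intro summable_sums l2seq_summable_cinner) auto

instance
proof
  fix f g h :: "'a hardy" and c d :: complex and r :: real
  show "c *\<^sub>C (f + g) = c *\<^sub>C f + c *\<^sub>C g" "(c + d) *\<^sub>C f = c *\<^sub>C f + d *\<^sub>C f"
    "c *\<^sub>C d *\<^sub>C f = (c * d) *\<^sub>C f" "r *\<^sub>R f = complex_of_real r *\<^sub>C f"
    by (rule hardy_coeff_eqI;
        simp add: scaleC_add_left scaleC_add_right scaleC_scaleC scaleR_scaleC)+
  show "cinner f g = cnj (cinner g f)"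
  proof (rule sums_unique2)
    show "(\<lambda>n. cinner (hardy_coeff f n) (hardy_coeff g n)) sums cinner f g"
      by (rule cinner_hardy_sums)
    show "(\<lambda>n. cinner (hardy_coeff f n) (hardy_coeff g n)) sums cnj (cinner g f)"
      using cinner_hardy_sums[of g f, THEN sums_cnj[THEN iffD2]]
      by (subst cinner_commute)
  qed
  show "cinner (f + g) h = cinner f h + cinner g h"
    using cinner_hardy_sums[of "f + g" h]
      sums_add[OF cinner_hardy_sums[of f h] cinner_hardy_sums[of g h]]
    by (simp add: cinner_add_left sums_unique2)
  show "cinner (c *\<^sub>C f) g = c * cinner f g"
    using cinner_hardy_sums[of "c *\<^sub>C f" g] sums_mult[OF cinner_hardy_sums[of f g], of c]
    by (simp add: cinner_scaleC_left sums_unique2)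
  show "inner f g = Re (cinner f g)"
    by (simp add: inner_hardy_def cinner_hardy_def)
qed

end


definition hardy_tensor ::
    "complex hardy \<Rightarrow> 'a::complex_hilbert \<Rightarrow> 'a hardy"  (infixr \<open>\<otimes>\<^sub>H\<close> 70)
  where "f \<otimes>\<^sub>H x = Abs_hardy (\<lambda>z. hardy_fun f z *\<^sub>C x)"

lemma hardy_tensor_power_series:
  assumes "l2seq a"
  shows "l2seq (\<lambda>n. a n *\<^sub>C x)"
    and "(\<lambda>z. power_series a z *\<^sub>C x) = power_series (\<lambda>n. a n *\<^sub>C x)"
proof -
  show "l2seq (\<lambda>n. a n *\<^sub>C x)"
    using assms by (auto simp: l2seq_def norm_scaleC power_mult_distrib intro: summable_mult2)
  have "power_series a z *\<^sub>C x = power_series (\<lambda>n. a n *\<^sub>C x) z" for z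
    using bounded_linear.suminf[OF bounded_linear_scaleC_left summable_power_series[OF assms], of z x]
    by (auto simp: power_series_def scaleC_scaleC scaleC_complex_def)
  then show "(\<lambda>z. power_series a z *\<^sub>C x) = power_series (\<lambda>n. a n *\<^sub>C x)" ..
qed

lemma hardy_coeff_tensor [simp]: "hardy_coeff (f \<otimes>\<^sub>H x) n = hardy_coeff f n *\<^sub>C x"
  by (simp add: hardy_tensor_def hardy_fun_eq hardy_tensor_power_series)

lemma hardy_fun_tensor: "hardy_fun (f \<otimes>\<^sub>H x) z = hardy_fun f z *\<^sub>C x"
proof -
  have "hardy_fun (f \<otimes>\<^sub>H x) = (\<lambda>z. hardy_fun f z *\<^sub>C x)"
    by (simp add: hardy_tensor_def hardy_fun_eq[of f] hardy_tensor_power_series)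
  then show ?thesis
    by simp
qed

lemma tensor_add_left: "(f + g) \<otimes>\<^sub>H x = f \<otimes>\<^sub>H x + g \<otimes>\<^sub>H x"
  by (rule hardy_coeff_eqI) (simp add: scaleC_add_left)

lemma tensor_add_right: "f \<otimes>\<^sub>H (x + y) = f \<otimes>\<^sub>H x + f \<otimes>\<^sub>H y"
  by (rule hardy_coeff_eqI) (simp add: scaleC_add_right)

lemma tensor_scaleC_left: "(c *\<^sub>C f) \<otimes>\<^sub>H x = c *\<^sub>C (f \<otimes>\<^sub>H x)"
  by (rule hardy_coeff_eqI) (simp add: scaleC_scaleC scaleC_complex_def)

lemma tensor_scaleC_right: "f \<otimes>\<^sub>H (c *\<^sub>C x) = c *\<^sub>C (f \<otimes>\<^sub>H x)"
  by (rule hardy_coeff_eqI) (simp add: scaleC_scaleC mult.commute)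

lemma cinner_tensor: "cinner (f \<otimes>\<^sub>H x) (g \<otimes>\<^sub>H y) = cinner f g * cinner x y"
proof (rule sums_unique2)
  show "(\<lambda>n. cinner (hardy_coeff (f \<otimes>\<^sub>H x) n) (hardy_coeff (g \<otimes>\<^sub>H y) n))
      sums cinner (f \<otimes>\<^sub>H x) (g \<otimes>\<^sub>H y)"
    by (rule cinner_hardy_sums)
  show "(\<lambda>n. cinner (hardy_coeff (f \<otimes>\<^sub>H x) n) (hardy_coeff (g \<otimes>\<^sub>H y) n))
      sums (cinner f g * cinner x y)"
    using sums_mult2[OF cinner_hardy_sums[of f g], of "cinner x y"]
    by (simp add: cinner_scaleC_left cinner_scaleC_right cinner_complex_def mult_ac)
qed

lemma norm_tensor: "norm (f \<otimes>\<^sub>H x) = norm f * norm x"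
proof -
  have "complex_of_real ((norm (f \<otimes>\<^sub>H x))\<^sup>2) = complex_of_real ((norm f * norm x)\<^sup>2)"
    by (simp only: cinner_self[symmetric] cinner_tensor)
       (simp add: cinner_self power_mult_distrib)
  then have "(norm (f \<otimes>\<^sub>H x))\<^sup>2 = (norm f * norm x)\<^sup>2"
    using of_real_eq_iff by blast
  then show ?thesis
    by (simp add: power2_eq_iff_nonneg)
qed

lemma tensor_0_left [simp]: "0 \<otimes>\<^sub>H x = 0"
  by (rule hardy_coeff_eqI) simp

lemma tensor_0_right [simp]: "f \<otimes>\<^sub>H 0 = 0"
  by (rule hardy_coeff_eqI) simp

lemma tensor_sum_left: "sum f A \<otimes>\<^sub>H x = (\<Sum>i\<in>A. f i \<otimes>\<^sub>H x)"
  by (induction A rule: infinite_finite_induct) (auto simp: tensor_add_left)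

lemma tensor_sum_right: "f \<otimes>\<^sub>H sum x A = (\<Sum>i\<in>A. f \<otimes>\<^sub>H x i)"
  by (induction A rule: infinite_finite_induct) (auto simp: tensor_add_right)

definition hardy_monom :: "nat \<Rightarrow> complex hardy"
  where "hardy_monom n = Abs_hardy (\<lambda>z. if cmod z < 1 then z ^ n else 0)"

lemma hardy_coeff_monom [simp]: "hardy_coeff (hardy_monom n) k = (if k = n then 1 else 0)"
proof -
  have "(\<lambda>z. if cmod z < 1 then z ^ n else 0) = power_series (\<lambda>k. if k = n then 1 else 0)"
  proof
    fix z :: complex
    have "(\<Sum>k. z ^ k *\<^sub>C (if k = n then 1 else 0 :: complex)) = z ^ n"
      by (subst suminf_finite[of "{n}"]) (auto simp: scaleC_complex_def)
    then show "(if cmod z < 1 then z ^ n else 0) = power_series (\<lambda>k. if k = n then 1 else 0) z"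
      by (simp add: power_series_def)
  qed
  moreover have "l2seq (\<lambda>k. if k = n then 1 else 0 :: complex)"
    by (rule l2seq_finite[of "Suc n"]) auto
  ultimately show ?thesis
    by (simp add: hardy_monom_def)
qed

lemma hardy_coeff_sum: "hardy_coeff (sum f A) n = (\<Sum>i\<in>A. hardy_coeff (f i) n)"
  by (induction A rule: infinite_finite_induct) auto

lemma hardy_expansion: "(\<lambda>n. hardy_monom n \<otimes>\<^sub>H hardy_coeff f n) sums f"
  unfolding sums_def
proof (rule LIM_zero_cancel, rule tendsto_norm_zero_cancel)
  define S where "S N = (\<Sum>n<N. hardy_monom n \<otimes>\<^sub>H hardy_coeff f n)" for N
  have coeff: "hardy_coeff (S N) n = (if n < N then hardy_coeff f n else 0)" for N n
  proof -
    have "hardy_coeff (S N) n = (\<Sum>k<N. if n = k then hardy_coeff f n else 0)"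
      unfolding S_def hardy_coeff_sum by (rule sum.cong) auto
    then show ?thesis
      by simp
  qed
  have "(norm (S N - f))\<^sup>2 = (\<Sum>n. (norm (hardy_coeff f (n + N)))\<^sup>2)" for N
  proof -
    have "(norm (S N - f))\<^sup>2 = (\<Sum>n. (norm (hardy_coeff (S N - f) n))\<^sup>2)"
      by (rule sums_unique[OF norm_hardy_sums])
    also have "\<dots> = (\<Sum>n. (norm (hardy_coeff (S N - f) (n + N)))\<^sup>2)
        + (\<Sum>n<N. (norm (hardy_coeff (S N - f) n))\<^sup>2)"
      by (rule suminf_split_initial_segment[OF sums_summable[OF norm_hardy_sums]])
    finally show ?thesis
      by (simp add: coeff)
  qed
  moreover have "(\<lambda>N. \<Sum>n. (norm (hardy_coeff f (n + N)))\<^sup>2) \<longlonglongrightarrow> 0"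
    by (rule suminf_exist_split2[OF sums_summable[OF norm_hardy_sums[of f]]])
  ultimately have "(\<lambda>N. (norm (S N - f))\<^sup>2) \<longlonglongrightarrow> 0"
    by simp
  then have "(\<lambda>N. sqrt ((norm (S N - f))\<^sup>2)) \<longlonglongrightarrow> sqrt 0"
    by (rule tendsto_real_sqrt)
  then show "(\<lambda>N. norm ((\<Sum>n<N. hardy_monom n \<otimes>\<^sub>H hardy_coeff f n) - f)) \<longlonglongrightarrow> 0"
    by (simp add: S_def)
qed

text \<open>The set of elementary tensors is closed under \<open>*\<^sub>C\<close>, so its real and complex spans agree.\<close>

lemma tensor_total: "closure (span {f \<otimes>\<^sub>H x |f x. True}) = (UNIV :: 'a::complex_hilbert hardy set)"
proof (rule UNIV_eq_I[symmetric])
  fix g :: "'a hardy"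
  show "g \<in> closure (span {f \<otimes>\<^sub>H x |f x. True})"
    unfolding closure_sequential
  proof (intro exI conjI allI)
    show "(\<lambda>N. \<Sum>n<N. hardy_monom n \<otimes>\<^sub>H hardy_coeff g n) \<longlonglongrightarrow> g"
      using hardy_expansion[of g] by (simp add: sums_def)
    show "(\<Sum>n<N. hardy_monom n \<otimes>\<^sub>H hardy_coeff g n) \<in> span {f \<otimes>\<^sub>H x |f x. True}" for N
      by (intro span_sum span_base) blast
  qed
qed

text \<open>For bounded \<open>A\<close> and \<open>B\<close>, \<open>tensor_op_works\<close> below shows that there is exactly one such operator.\<close>

definition tensor_op ::
    "(complex hardy \<Rightarrow> complex hardy) \<Rightarrow> ('a::complex_hilbert \<Rightarrow> 'b::complex_hilbert) \<Rightarrow>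
     'a hardy \<Rightarrow> 'b hardy"  (infixr \<open>\<otimes>\<close> 70)
  where "A \<otimes> B = (THE T. bounded_clinear T \<and> (\<forall>f x. T (f \<otimes>\<^sub>H x) = A f \<otimes>\<^sub>H B x))"

lemma bounded_clinear_eq_on_tensors:
  assumes S: "bounded_clinear S" and T: "bounded_clinear T"
    and eq: "\<And>f x. S (f \<otimes>\<^sub>H x) = T (f \<otimes>\<^sub>H x)"
  shows "S = T"
proof
  fix g
  have "(\<lambda>n. S (hardy_monom n \<otimes>\<^sub>H hardy_coeff g n)) sums S g"
    "(\<lambda>n. T (hardy_monom n \<otimes>\<^sub>H hardy_coeff g n)) sums T g"
    by (rule bounded_linear.sums[OF bounded_clinear_bounded_linear hardy_expansion]; fact)+
  then show "S g = T g"
    by (simp add: eq sums_unique2)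
qed

lemma finite_orthonormal_basis:
  fixes x :: "nat \<Rightarrow> 'a::complex_hilbert"
  assumes "finite I"
  shows "\<exists>(M::nat) u c. (\<forall>i<M. \<forall>j<M. cinner (u i) (u j) = (if i = j then 1 else 0)) \<and>
    (\<forall>n\<in>I. x n = (\<Sum>j<M. c n j *\<^sub>C u j))"
  using assms
proof (induction I rule: finite_induct)
  case empty
  show ?case
    by (rule exI[of _ 0]) auto
next
  case (insert m I)
  then obtain M :: nat and u c where
    on: "\<And>i j. i < M \<Longrightarrow> j < M \<Longrightarrow> cinner (u i) (u j) = (if i = j then 1 else 0)"
    and x: "\<And>n. n \<in> I \<Longrightarrow> x n = (\<Sum>j<M. c n j *\<^sub>C u j)"
    by blast
  define p where "p = (\<Sum>j<M. cinner (x m) (u j) *\<^sub>C u j)"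
  define r where "r = x m - p"
  have orth: "cinner r (u i) = 0" if "i < M" for i
  proof -
    have "cinner p (u i) = (\<Sum>j<M. if i = j then cinner (x m) (u i) else 0)"
      unfolding p_def cinner_sum_left
      by (rule sum.cong) (auto simp: cinner_scaleC_left on that)
    then show ?thesis
      using that by (simp add: r_def cinner_diff_left)
  qed
  have orth': "cinner (u i) r = 0" if "i < M" for i
    using orth[OF that] by (subst cinner_commute) simp
  define u' where "u' = u(M := complex_of_real (inverse (norm r)) *\<^sub>C r)"
  define c' where "c' n = (if n = m then (\<lambda>j. cinner (x m) (u j))(M := norm r) else (c n)(M := 0))"
    for n
  show ?case
  proof (cases "r = 0")
    case True
    have "\<forall>n\<in>insert m I. x n = (\<Sum>j<M. c' n j *\<^sub>C u j)"
      using True x insert.hyps by (auto simp: c'_def r_def p_def intro!: sum.cong)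
    then show ?thesis
      using on by blast
  next
    case False
    have un: "cinner (u' M) (u' M) = 1"
      using False
      by (simp add: u'_def cinner_self norm_scaleC norm_inverse)
    have "\<forall>i<Suc M. \<forall>j<Suc M. cinner (u' i) (u' j) = (if i = j then 1 else 0)"
      using un
      by (auto simp: less_Suc_eq u'_def on cinner_scaleC_left cinner_scaleC_right orth orth')
    moreover have "x n = (\<Sum>j<Suc M. c' n j *\<^sub>C u' j)" if "n \<in> insert m I" for n
    proof (cases "n = m")
      case True
      have "(\<Sum>j<M. c' m j *\<^sub>C u' j) = p"
        by (simp add: c'_def u'_def p_def)
      moreover have "c' m M *\<^sub>C u' M = r"
        using False by (simp add: c'_def u'_def scaleC_scaleC flip: of_real_mult)
      ultimately show ?thesis
        using True by (simp add: r_def)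
    next
      case False
      then show ?thesis
        using x[of n] that by (simp add: c'_def u'_def)
    qed
    ultimately show ?thesis
      by blast
  qed
qed

lemma norm_sum_tensor_orthonormal:
  fixes M :: nat
  assumes "\<And>i j. i < M \<Longrightarrow> j < M \<Longrightarrow> cinner (u i) (u j) = (if i = j then 1 else 0)"
  shows "(norm (\<Sum>j<M. g j \<otimes>\<^sub>H u j))\<^sup>2 = (\<Sum>j<M. (norm (g j))\<^sup>2)"
proof -
  have "complex_of_real ((norm (\<Sum>j<M. g j \<otimes>\<^sub>H u j))\<^sup>2)
      = (\<Sum>i<M. \<Sum>j<M. cinner (g i) (g j) * cinner (u i) (u j))"
    by (simp only: cinner_self[symmetric] cinner_sum_left cinner_sum_right cinner_tensor)
       (rule sum.swap)
  also have "\<dots> = (\<Sum>i<M. \<Sum>j<M. if i = j then cinner (g i) (g i) else 0)"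
    using assms by (intro sum.cong) auto
  also have "\<dots> = (\<Sum>i<M. cinner (g i) (g i))"
    by (intro sum.cong) auto
  also have "\<dots> = complex_of_real (\<Sum>i<M. (norm (g i))\<^sup>2)"
    by (simp add: cinner_self)
  finally show ?thesis
    using of_real_eq_iff by blast
qed

lemma norm_sum_tensor_op_le:
  fixes x :: "nat \<Rightarrow> 'a::complex_hilbert"
  assumes A: "bounded_clinear A" and I: "finite I"
  shows "norm (\<Sum>n\<in>I. A (f n) \<otimes>\<^sub>H x n) \<le> onorm A * norm (\<Sum>n\<in>I. f n \<otimes>\<^sub>H x n)"
proof -
  obtain M :: nat and u c where
    on: "\<And>i j. i < M \<Longrightarrow> j < M \<Longrightarrow> cinner (u i) (u j) = (if i = j then 1 else 0)"
    and x: "\<And>n. n \<in> I \<Longrightarrow> x n = (\<Sum>j<M. c n j *\<^sub>C u j)"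
    using finite_orthonormal_basis[OF I, of x] by blast
  have bl: "bounded_linear A"
    using A by (rule bounded_clinear_bounded_linear)
  define g where "g j = (\<Sum>n\<in>I. c n j *\<^sub>C f n)" for j
  have *: "(\<Sum>n\<in>I. h n \<otimes>\<^sub>H x n) = (\<Sum>j<M. (\<Sum>n\<in>I. c n j *\<^sub>C h n) \<otimes>\<^sub>H u j)" for h
  proof -
    have "(\<Sum>n\<in>I. h n \<otimes>\<^sub>H x n) = (\<Sum>n\<in>I. \<Sum>j<M. (c n j *\<^sub>C h n) \<otimes>\<^sub>H u j)"
      by (rule sum.cong) (auto simp: x tensor_sum_right tensor_scaleC_left tensor_scaleC_right)
    also have "\<dots> = (\<Sum>j<M. \<Sum>n\<in>I. (c n j *\<^sub>C h n) \<otimes>\<^sub>H u j)"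
      by (rule sum.swap)
    finally show ?thesis
      by (simp add: tensor_sum_left)
  qed
  have "A (g j) = (\<Sum>n\<in>I. c n j *\<^sub>C A (f n))" for j
    by (simp add: g_def linear_sum[OF bounded_linear.linear[OF bl]] bounded_clinear_scaleC[OF A])
  then have "(norm (\<Sum>n\<in>I. A (f n) \<otimes>\<^sub>H x n))\<^sup>2 = (\<Sum>j<M. (norm (A (g j)))\<^sup>2)"
    unfolding * by (simp add: norm_sum_tensor_orthonormal[OF on])
  also have "\<dots> \<le> (\<Sum>j<M. (onorm A * norm (g j))\<^sup>2)"
    by (intro sum_mono power_mono onorm bl) auto
  also have "\<dots> = (onorm A)\<^sup>2 * (\<Sum>j<M. (norm (g j))\<^sup>2)"
    by (simp add: power_mult_distrib sum_distrib_left)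
  also have "\<dots> = (onorm A * norm (\<Sum>n\<in>I. f n \<otimes>\<^sub>H x n))\<^sup>2"
    unfolding * by (simp add: norm_sum_tensor_orthonormal[OF on] power_mult_distrib g_def)
  finally show ?thesis
    using onorm_pos_le[OF bl] by (simp add: power2_le_iff_abs_le)
qed

lemma tensor_op_ex_left:
  assumes A: "bounded_clinear A"
  shows "\<exists>T :: 'a::complex_hilbert hardy \<Rightarrow> 'a hardy.
    bounded_clinear T \<and> (\<forall>f x. T (f \<otimes>\<^sub>H x) = A f \<otimes>\<^sub>H x)"
proof -
  have bl: "bounded_linear A"
    using A by (rule bounded_clinear_bounded_linear)
  define S where "S g N = (\<Sum>n<N. hardy_monom n \<otimes>\<^sub>H hardy_coeff g n)" for g :: "'a hardy" and N
  define R where "R g N = (\<Sum>n<N. A (hardy_monom n) \<otimes>\<^sub>H hardy_coeff g n)" for g :: "'a hardy" and N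
  have S: "S g \<longlonglongrightarrow> g" for g
    using hardy_expansion[of g] by (simp add: sums_def S_def[abs_def])
  have le: "norm (R g N) \<le> onorm A * norm (S g N)" for g N
    unfolding R_def S_def by (rule norm_sum_tensor_op_le[OF A]) simp
  have diff_le: "norm (R g N - R g M) \<le> onorm A * norm (S g N - S g M)" if "M \<le> N" for g M N
  proof -
    have "R g N - R g M = (\<Sum>n\<in>{..<N} - {..<M}. A (hardy_monom n) \<otimes>\<^sub>H hardy_coeff g n)"
      "S g N - S g M = (\<Sum>n\<in>{..<N} - {..<M}. hardy_monom n \<otimes>\<^sub>H hardy_coeff g n)"
      unfolding R_def S_def using that by (subst sum_diff; simp)+
    then show ?thesis
      using norm_sum_tensor_op_le[OF A, of "{..<N} - {..<M}"] by simp
  qed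
  have "Cauchy (R g)" for g
  proof (rule CauchyI')
    fix e :: real
    assume "e > 0"
    define K where "K = onorm A + 1"
    have K: "K > 0" "onorm A \<le> K"
      using onorm_pos_le[OF bl] by (auto simp: K_def)
    have "Cauchy (S g)"
      using S by (rule LIMSEQ_imp_Cauchy)
    then obtain M where M: "\<And>m n. m \<ge> M \<Longrightarrow> n \<ge> M \<Longrightarrow> norm (S g m - S g n) < e / K"
      using CauchyD[of "S g" "e / K"] \<open>e > 0\<close> K(1) by auto
    have "dist (R g m) (R g n) < e" if "m \<ge> M" "n > m" for m n
    proof -
      have "dist (R g m) (R g n) \<le> onorm A * norm (S g n - S g m)"
        using diff_le[of m n g] that by (simp add: dist_norm norm_minus_commute)
      also have "\<dots> \<le> K * norm (S g n - S g m)"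
        using K by (simp add: mult_right_mono)
      also have "\<dots> < e"
        using M[of n m] that K by (simp add: field_simps)
      finally show ?thesis .
    qed
    then show "\<exists>M. \<forall>m\<ge>M. \<forall>n>m. dist (R g m) (R g n) < e"
      by blast
  qed
  then have "\<exists>l. R g \<longlonglongrightarrow> l" for g
    by (meson Cauchy_convergent convergentD)
  then obtain T where T: "\<And>g. R g \<longlonglongrightarrow> T g"
    by metis
  have "bounded_clinear T"
  proof (rule bounded_clinearI)
    show "T (g + h) = T g + T h" for g h
    proof (rule LIMSEQ_unique[OF T])
      have "R (g + h) = (\<lambda>N. R g N + R h N)"
        by (simp add: R_def fun_eq_iff tensor_add_right sum.distrib)
      then show "R (g + h) \<longlonglongrightarrow> T g + T h"
        by (simp add: tendsto_add T)
    qed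
    show "T (c *\<^sub>C g) = c *\<^sub>C T g" for c g
    proof (rule LIMSEQ_unique[OF T])
      have "R (c *\<^sub>C g) = (\<lambda>N. c *\<^sub>C R g N)"
        by (simp add: R_def fun_eq_iff tensor_scaleC_right scaleC_sum_right)
      then show "R (c *\<^sub>C g) \<longlonglongrightarrow> c *\<^sub>C T g"
        by (simp add: bounded_linear.tendsto[OF bounded_linear_scaleC_right T])
    qed
    show "norm (T g) \<le> norm g * onorm A" for g
    proof (rule LIMSEQ_le)
      show "(\<lambda>N. norm (R g N)) \<longlonglongrightarrow> norm (T g)"
        by (intro tendsto_norm T)
      show "(\<lambda>N. norm (S g N) * onorm A) \<longlonglongrightarrow> norm g * onorm A"
        by (intro tendsto_intros S)
      show "\<exists>N. \<forall>n\<ge>N. norm (R g n) \<le> norm (S g n) * onorm A"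
        using le by (simp add: mult.commute)
    qed
  qed
  moreover have "T (f \<otimes>\<^sub>H x) = A f \<otimes>\<^sub>H x" for f x
  proof (rule LIMSEQ_unique[OF T])
    have bx: "bounded_linear (\<lambda>h. A h \<otimes>\<^sub>H x)"
    proof (rule bounded_linear_compose[OF _ bl])
      show "bounded_linear (\<lambda>h. h \<otimes>\<^sub>H x)"
        by (rule bounded_linear_intro[where K = "norm x"])
           (auto simp: tensor_add_left scaleR_scaleC tensor_scaleC_left norm_tensor)
    qed
    have "hardy_monom n \<otimes>\<^sub>H hardy_coeff f n = hardy_coeff f n *\<^sub>C hardy_monom n" for n
      by (rule hardy_coeff_eqI) (auto simp: scaleC_complex_def)
    then have "(\<lambda>n. hardy_coeff f n *\<^sub>C hardy_monom n) sums f"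
      using hardy_expansion[of f] by simp
    from bounded_linear.sums[OF bx this]
    have "(\<lambda>n. A (hardy_monom n) \<otimes>\<^sub>H hardy_coeff (f \<otimes>\<^sub>H x) n) sums (A f \<otimes>\<^sub>H x)"
      by (simp add: bounded_clinear_scaleC[OF A] tensor_scaleC_left tensor_scaleC_right)
    then show "R (f \<otimes>\<^sub>H x) \<longlonglongrightarrow> A f \<otimes>\<^sub>H x"
      by (simp add: sums_def R_def[abs_def])
  qed
  ultimately show ?thesis
    by blast
qed

lemma tensor_op_ex_right:
  fixes B :: "'a::complex_hilbert \<Rightarrow> 'b::complex_hilbert"
  assumes B: "bounded_clinear B"
  shows "\<exists>T. bounded_clinear T \<and> (\<forall>f x. T (f \<otimes>\<^sub>H x) = f \<otimes>\<^sub>H B x)"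
proof -
  have bl: "bounded_linear B"
    using B by (rule bounded_clinear_bounded_linear)
  have le: "(norm (B x))\<^sup>2 \<le> (onorm B)\<^sup>2 * (norm x)\<^sup>2" for x
    using power_mono[OF onorm[OF bl, of x], of 2] by (simp add: power_mult_distrib)
  have sm: "summable (\<lambda>n. (onorm B)\<^sup>2 * (norm (hardy_coeff g n))\<^sup>2)" for g
    by (intro summable_mult sums_summable[OF norm_hardy_sums])
  have l2: "l2seq (\<lambda>n. B (hardy_coeff g n))" for g
    unfolding l2seq_def by (rule summable_comparison_test'[OF sm[of g], where N = 0]) (simp add: le)
  define T where "T g = Abs_hardy (power_series (\<lambda>n. B (hardy_coeff g n)))" for g
  have coeff: "hardy_coeff (T g) n = B (hardy_coeff g n)" for g n
    by (simp add: T_def l2)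
  have "bounded_clinear T"
  proof (rule bounded_clinearI)
    show "T (g + h) = T g + T h" for g h
      by (rule hardy_coeff_eqI) (simp add: coeff linear_add[OF bounded_linear.linear[OF bl]])
    show "T (c *\<^sub>C g) = c *\<^sub>C T g" for c g
      by (rule hardy_coeff_eqI) (simp add: coeff bounded_clinear_scaleC[OF B])
    show "norm (T g) \<le> norm g * onorm B" for g
    proof -
      have "(norm (T g))\<^sup>2 \<le> (onorm B)\<^sup>2 * (norm g)\<^sup>2"
        using le by (intro sums_le[OF _ norm_hardy_sums sums_mult[OF norm_hardy_sums]])
                    (simp add: coeff)
      then have "(norm (T g))\<^sup>2 \<le> (norm g * onorm B)\<^sup>2"
        by (simp add: power_mult_distrib mult.commute)
      then show ?thesis
        using onorm_pos_le[OF bl] by (simp add: power2_le_iff_abs_le)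
    qed
  qed
  moreover have "T (f \<otimes>\<^sub>H x) = f \<otimes>\<^sub>H B x" for f x
    by (rule hardy_coeff_eqI) (simp add: coeff bounded_clinear_scaleC[OF B])
  ultimately show ?thesis
    by blast
qed

lemma tensor_op_works:
  fixes B :: "'a::complex_hilbert \<Rightarrow> 'b::complex_hilbert"
  assumes A: "bounded_clinear A" and B: "bounded_clinear B"
  shows "bounded_clinear (A \<otimes> B)" and "(A \<otimes> B) (f \<otimes>\<^sub>H x) = A f \<otimes>\<^sub>H B x"
proof -
  obtain S :: "'b hardy \<Rightarrow> 'b hardy"
    where S: "bounded_clinear S" "\<And>f x. S (f \<otimes>\<^sub>H x) = A f \<otimes>\<^sub>H x"
    using tensor_op_ex_left[OF A] by blast
  obtain T where T: "bounded_clinear T" "\<And>f x. T (f \<otimes>\<^sub>H x) = f \<otimes>\<^sub>H B x"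
    using tensor_op_ex_right[OF B] by blast
  have ST: "bounded_clinear (S \<circ> T) \<and> (\<forall>f x. (S \<circ> T) (f \<otimes>\<^sub>H x) = A f \<otimes>\<^sub>H B x)"
    using S T by (simp add: bounded_clinear_compose)
  have "\<exists>!T. bounded_clinear T \<and> (\<forall>f x. T (f \<otimes>\<^sub>H x) = A f \<otimes>\<^sub>H B x)"
  proof (rule ex1I[of _ "S \<circ> T"])
    show "bounded_clinear (S \<circ> T) \<and> (\<forall>f x. (S \<circ> T) (f \<otimes>\<^sub>H x) = A f \<otimes>\<^sub>H B x)"
      by (rule ST)
    show "T' = S \<circ> T" if "bounded_clinear T' \<and> (\<forall>f x. T' (f \<otimes>\<^sub>H x) = A f \<otimes>\<^sub>H B x)" for T'
      using that ST by (intro bounded_clinear_eq_on_tensors) auto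
  qed
  from theI'[OF this]
  show "bounded_clinear (A \<otimes> B)" and "(A \<otimes> B) (f \<otimes>\<^sub>H x) = A f \<otimes>\<^sub>H B x"
    unfolding tensor_op_def by auto
qed


section \<open>Multiplication by \<open>z\<close> and the rotation operators\<close>

definition mult_z :: "complex hardy \<Rightarrow> complex hardy"  (\<open>M\<^sub>z\<close>)
  where "M\<^sub>z f = Abs_hardy (\<lambda>z. z * hardy_fun f z)"

definition rotation :: "complex \<Rightarrow> complex hardy \<Rightarrow> complex hardy"  (\<open>R\<^bsub>_\<^esub>\<close>)
  where "R\<^bsub>q\<^esub> f = Abs_hardy (\<lambda>z. hardy_fun f (q * z))"

lemma mult_z_power_series:
  fixes a :: "nat \<Rightarrow> complex"
  assumes "l2seq a"
  defines "b \<equiv> \<lambda>n. if n = 0 then 0 else a (n - 1)"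
  shows "l2seq b" and "(\<lambda>z. z * power_series a z) = power_series b"
proof -
  have "summable (\<lambda>n. (norm (b (Suc n)))\<^sup>2)"
    using assms by (simp add: l2seq_def)
  then show b: "l2seq b"
    unfolding l2seq_def by (subst (asm) summable_Suc_iff)
  have "z * power_series a z = power_series b z" for z
  proof (cases "cmod z < 1")
    case True
    have "(\<Sum>n. z ^ n *\<^sub>C b n) = (\<Sum>n. z ^ Suc n *\<^sub>C b (Suc n))"
      using suminf_split_head[OF summable_power_series[OF b True]] by (simp add: b_def)
    also have "\<dots> = z * (\<Sum>n. z ^ n *\<^sub>C a n)"
      using suminf_mult[OF summable_power_series[OF assms(1) True], of z]
      by (simp add: b_def scaleC_complex_def mult.assoc)
    finally show ?thesis
      using True by (simp add: power_series_def)
  qed (simp add: power_series_def)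
  then show "(\<lambda>z. z * power_series a z) = power_series b" ..
qed

lemma rotation_power_series:
  fixes a :: "nat \<Rightarrow> complex"
  assumes "l2seq a" "cmod q = 1"
  shows "l2seq (\<lambda>n. q ^ n * a n)"
    and "(\<lambda>z. power_series a (q * z)) = power_series (\<lambda>n. q ^ n * a n)"
proof -
  show "l2seq (\<lambda>n. q ^ n * a n)"
    using assms by (simp add: l2seq_def norm_mult norm_power)
  show "(\<lambda>z. power_series a (q * z)) = power_series (\<lambda>n. q ^ n * a n)"
    using assms(2)
    by (auto simp: power_series_def fun_eq_iff scaleC_complex_def norm_mult power_mult_distrib mult_ac)
qed

lemma hardy_fun_mult_z: "hardy_fun (M\<^sub>z f) z = z * hardy_fun f z"
proof -
  have "hardy_fun (M\<^sub>z f) = (\<lambda>z. z * hardy_fun f z)"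
    using mult_z_power_series[OF l2seq_hardy_coeff[of f]]
    by (simp add: mult_z_def hardy_fun_eq[of f])
  then show ?thesis
    by simp
qed

lemma hardy_coeff_mult_z: "hardy_coeff (M\<^sub>z f) n = (if n = 0 then 0 else hardy_coeff f (n - 1))"
  using mult_z_power_series[OF l2seq_hardy_coeff[of f]]
  by (simp add: mult_z_def hardy_fun_eq[of f])

lemma hardy_fun_rotation: "cmod q = 1 \<Longrightarrow> hardy_fun (R\<^bsub>q\<^esub> f) z = hardy_fun f (q * z)"
proof -
  assume "cmod q = 1"
  then have "hardy_fun (R\<^bsub>q\<^esub> f) = (\<lambda>z. hardy_fun f (q * z))"
    using rotation_power_series[OF l2seq_hardy_coeff[of f], of q]
    by (simp add: rotation_def hardy_fun_eq[of f])
  then show ?thesis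
    by simp
qed

lemma hardy_coeff_rotation: "cmod q = 1 \<Longrightarrow> hardy_coeff (R\<^bsub>q\<^esub> f) n = q ^ n * hardy_coeff f n"
  using rotation_power_series[OF l2seq_hardy_coeff[of f], of q]
  by (simp add: rotation_def hardy_fun_eq[of f])

lemma isometry_op_mult_z: "isometry_op M\<^sub>z"
proof -
  have norm: "norm (M\<^sub>z f) = norm f" for f
  proof -
    have "(\<lambda>n. (norm (hardy_coeff (M\<^sub>z f) (Suc n)))\<^sup>2) sums (norm f)\<^sup>2"
      using norm_hardy_sums[of f] by (simp add: hardy_coeff_mult_z)
    then have "(\<lambda>n. (norm (hardy_coeff (M\<^sub>z f) n))\<^sup>2) sums (norm f)\<^sup>2"
      by (subst (asm) sums_Suc_iff) (simp add: hardy_coeff_mult_z)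
    then have "(norm (M\<^sub>z f))\<^sup>2 = (norm f)\<^sup>2"
      using norm_hardy_sums sums_unique2 by blast
    then show ?thesis
      by (simp add: power2_eq_iff_nonneg)
  qed
  have "bounded_clinear M\<^sub>z"
  proof (rule bounded_clinearI[where K = 1])
    show "M\<^sub>z (f + g) = M\<^sub>z f + M\<^sub>z g" for f g
      by (rule hardy_coeff_eqI) (simp add: hardy_coeff_mult_z)
    show "M\<^sub>z (c *\<^sub>C f) = c *\<^sub>C M\<^sub>z f" for c f
      by (rule hardy_coeff_eqI) (simp add: hardy_coeff_mult_z)
  qed (simp add: norm)
  then show ?thesis
    by (simp add: isometry_op_def norm)
qed

lemma isometry_op_rotation:
  assumes q: "cmod q = 1"
  shows "isometry_op R\<^bsub>q\<^esub>"
proof -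
  have norm: "norm (R\<^bsub>q\<^esub> f) = norm f" for f
  proof -
    have "(\<lambda>n. (norm (hardy_coeff (R\<^bsub>q\<^esub> f) n))\<^sup>2) sums (norm f)\<^sup>2"
      using norm_hardy_sums[of f] by (simp add: hardy_coeff_rotation q norm_mult norm_power)
    then have "(norm (R\<^bsub>q\<^esub> f))\<^sup>2 = (norm f)\<^sup>2"
      using norm_hardy_sums sums_unique2 by blast
    then show ?thesis
      by (simp add: power2_eq_iff_nonneg)
  qed
  have "bounded_clinear R\<^bsub>q\<^esub>"
  proof (rule bounded_clinearI[where K = 1])
    show "R\<^bsub>q\<^esub> (f + g) = R\<^bsub>q\<^esub> f + R\<^bsub>q\<^esub> g" for f g
      by (rule hardy_coeff_eqI) (simp add: hardy_coeff_rotation q ring_distribs)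
    show "R\<^bsub>q\<^esub> (c *\<^sub>C f) = c *\<^sub>C R\<^bsub>q\<^esub> f" for c f
      by (rule hardy_coeff_eqI) (simp add: hardy_coeff_rotation q scaleC_complex_def mult_ac)
  qed (simp add: norm)
  then show ?thesis
    by (simp add: isometry_op_def norm)
qed


section \<open>BCL tuples\<close>

text \<open>
  The conditions on \<open>(\<F>, \<K>\<^sub>u; P, U, W\<^sub>1, W\<^sub>2)\<close> shared by both kinds of tuples. The Hilbert spaces
  \<open>\<F>\<close> and \<open>\<K>\<^sub>u\<close> are the types \<open>'f\<close> and \<open>'k\<close>.
\<close>

definition BCL_data ::
    "complex \<Rightarrow> ('f::complex_hilbert \<Rightarrow> 'f) \<Rightarrow> ('f \<Rightarrow> 'f) \<Rightarrow>
     ('k::complex_hilbert \<Rightarrow> 'k) \<Rightarrow> ('k \<Rightarrow> 'k) \<Rightarrow> bool"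
  where "BCL_data q P U W\<^sub>1 W\<^sub>2 \<longleftrightarrow>
    orthogonal_projection P \<and> unitary_op U \<and>
    unitary_op W\<^sub>1 \<and> unitary_op W\<^sub>2 \<and> q_commutative q W\<^sub>1 W\<^sub>2"

definition BCL1_tuple ::
    "complex \<Rightarrow> ('h::complex_hilbert \<Rightarrow> 'h) \<times> ('h \<Rightarrow> 'h) \<Rightarrow>
     ('f::complex_hilbert \<Rightarrow> 'f) \<Rightarrow> ('f \<Rightarrow> 'f) \<Rightarrow>
     ('k::complex_hilbert \<Rightarrow> 'k) \<Rightarrow> ('k \<Rightarrow> 'k) \<Rightarrow> bool"
  where "BCL1_tuple q V P U W\<^sub>1 W\<^sub>2 \<longleftrightarrow>
    BCL_data q P U W\<^sub>1 W\<^sub>2 \<and>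
    jointly_unitarily_equivalent V
      ((R\<^bsub>q\<^esub> \<otimes> (P\<^sup>\<bottom> \<circ> U) \<boxplus> (M\<^sub>z \<circ> R\<^bsub>q\<^esub>) \<otimes> (P \<circ> U)) \<oplus>\<^sub>H W\<^sub>1,
       (R\<^bsub>cnj q\<^esub> \<otimes> (U\<^sup>\<star> \<circ> P) \<boxplus> (R\<^bsub>cnj q\<^esub> \<circ> M\<^sub>z) \<otimes> (U\<^sup>\<star> \<circ> P\<^sup>\<bottom>)) \<oplus>\<^sub>H W\<^sub>2)"

definition BCL2_tuple ::
    "complex \<Rightarrow> ('h::complex_hilbert \<Rightarrow> 'h) \<times> ('h \<Rightarrow> 'h) \<Rightarrow>
     ('f::complex_hilbert \<Rightarrow> 'f) \<Rightarrow> ('f \<Rightarrow> 'f) \<Rightarrow>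
     ('k::complex_hilbert \<Rightarrow> 'k) \<Rightarrow> ('k \<Rightarrow> 'k) \<Rightarrow> bool"
  where "BCL2_tuple q V P U W\<^sub>1 W\<^sub>2 \<longleftrightarrow>
    BCL_data q P U W\<^sub>1 W\<^sub>2 \<and>
    jointly_unitarily_equivalent V
      ((R\<^bsub>q\<^esub> \<otimes> (U\<^sup>\<star> \<circ> P\<^sup>\<bottom>) \<boxplus> (M\<^sub>z \<circ> R\<^bsub>q\<^esub>) \<otimes> (U\<^sup>\<star> \<circ> P)) \<oplus>\<^sub>H W\<^sub>1,
       (R\<^bsub>cnj q\<^esub> \<otimes> (P \<circ> U) \<boxplus> (R\<^bsub>cnj q\<^esub> \<circ> M\<^sub>z) \<otimes> (P\<^sup>\<bottom> \<circ> U)) \<oplus>\<^sub>H W\<^sub>2)"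

end

(*
  Both model pairs have the shape
    (R_q (x) A + M_z R_q (x) B) (+) W_1,  (R_qbar (x) C + R_qbar M_z (x) D) (+) W_2
  with AC = 0, BD = 0 and AD + BC = I, so the product of the two operators is
  (M_z (x) I) (+) W_1 W_2. A unitary intertwining two such pairs intertwines these products; it
  therefore respects their unitary parts and, on the shift parts, the wandering subspaces
  1 (x) F. Its restrictions are the required unitaries omega_u and omega: comparing the
  coefficients of T_j (1 (x) x) shows that omega intertwines A, B, C and D, from which P and U
  are recovered.
*)
theory Submission
  imports Defs
begin

section \<open>Unitary operators and joint unitary equivalence\<close>

lemma bounded_clinear_add: "bounded_clinear T \<Longrightarrow> T (x + y) = T x + T y"
  by (simp add: bounded_clinear_def linear_add bounded_linear.linear)

lemma bounded_clinear_0: "bounded_clinear T \<Longrightarrow> T 0 = 0"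
  by (simp add: bounded_clinear_def linear_0 bounded_linear.linear)

lemma bounded_clinear_diff: "bounded_clinear T \<Longrightarrow> T (x - y) = T x - T y"
  by (simp add: bounded_clinear_def linear_diff bounded_linear.linear)

lemma bounded_clinear_id: "bounded_clinear id"
  by (rule bounded_clinearI[where K = 1]) auto

lemma isometry_op_bounded_clinear: "isometry_op V \<Longrightarrow> bounded_clinear V"
  by (simp add: isometry_op_def)

lemma unitary_op_bounded_clinear: "unitary_op U \<Longrightarrow> bounded_clinear U"
  by (simp add: unitary_op_def isometry_op_def)

lemma isometry_opI:
  assumes "\<And>x y. T (x + y) = T x + T y" "\<And>c x. T (c *\<^sub>C x) = c *\<^sub>C T x"
    and "\<And>x. norm (T x) = norm x"
  shows "isometry_op T"
  using assms by (auto simp: isometry_op_def intro!: bounded_clinearI[where K = 1])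

lemma unitary_op_inv_simps:
  assumes "unitary_op U"
  shows "U (inv U y) = y" "inv U (U x) = x"
  using unitary_op_bij[OF assms] by (auto simp: bij_def surj_f_inv_f)

lemma unitary_op_inv:
  assumes U: "unitary_op U"
  shows "unitary_op (inv U)"
proof -
  note bc = unitary_op_bounded_clinear[OF U]
  have eqI: "inv U x = y" if "U y = x" for x y
    using that unitary_op_inv_simps(2)[OF U] by blast
  have "isometry_op (inv U)"
  proof (rule isometry_opI)
    show "inv U (x + y) = inv U x + inv U y" for x y
      by (rule eqI) (simp add: bounded_clinear_add[OF bc] unitary_op_inv_simps[OF U])
    show "inv U (c *\<^sub>C x) = c *\<^sub>C inv U x" for c x
      by (rule eqI) (simp add: bounded_clinear_scaleC[OF bc] unitary_op_inv_simps[OF U])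
    show "norm (inv U x) = norm x" for x
      using U unitary_op_inv_simps(1)[OF U, of x] by (metis unitary_op_def isometry_op_def)
  qed
  then show ?thesis
    using unitary_op_bij[OF U] by (simp add: unitary_op_def bij_imp_bij_inv bij_is_surj)
qed

lemma unitary_op_compose: "unitary_op S \<Longrightarrow> unitary_op T \<Longrightarrow> unitary_op (S \<circ> T)"
  using comp_surj[of T S] by (simp add: unitary_op_def isometry_op_def bounded_clinear_compose)

lemma intertwine_inv:
  assumes "unitary_op S" "unitary_op T" "\<And>x. \<omega> (S x) = T (\<omega> x)"
  shows "\<omega> (inv S x) = inv T (\<omega> x)"
  by (metis assms unitary_op_inv_simps)

section \<open>Joint unitary equivalence is symmetric and transitive\<close>

lemma jointly_unitarily_equivalent_sym:
  assumes "jointly_unitarily_equivalent A B"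
  shows "jointly_unitarily_equivalent B A"
proof -
  obtain A\<^sub>1 A\<^sub>2 B\<^sub>1 B\<^sub>2 where AB: "A = (A\<^sub>1, A\<^sub>2)" "B = (B\<^sub>1, B\<^sub>2)"
    by (cases A, cases B) auto
  obtain \<tau> where \<tau>: "unitary_op \<tau>" "\<tau> \<circ> A\<^sub>1 = B\<^sub>1 \<circ> \<tau>" "\<tau> \<circ> A\<^sub>2 = B\<^sub>2 \<circ> \<tau>"
    using assms by (auto simp: jointly_unitarily_equivalent_def AB)
  have "inv \<tau> \<circ> B\<^sub>1 = A\<^sub>1 \<circ> inv \<tau>" "inv \<tau> \<circ> B\<^sub>2 = A\<^sub>2 \<circ> inv \<tau>"
    using \<tau> unitary_op_inv_simps[OF \<tau>(1)] by (simp_all add: fun_eq_iff) metis+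
  then show ?thesis
    using unitary_op_inv[OF \<tau>(1)] by (auto simp: jointly_unitarily_equivalent_def AB)
qed

lemma jointly_unitarily_equivalent_trans:
  assumes "jointly_unitarily_equivalent A B" "jointly_unitarily_equivalent B C"
  shows "jointly_unitarily_equivalent A C"
proof -
  obtain A\<^sub>1 A\<^sub>2 B\<^sub>1 B\<^sub>2 C\<^sub>1 C\<^sub>2 where ABC: "A = (A\<^sub>1, A\<^sub>2)" "B = (B\<^sub>1, B\<^sub>2)" "C = (C\<^sub>1, C\<^sub>2)"
    by (cases A, cases B, cases C) auto
  obtain \<sigma> where \<sigma>: "unitary_op \<sigma>" "\<sigma> \<circ> A\<^sub>1 = B\<^sub>1 \<circ> \<sigma>" "\<sigma> \<circ> A\<^sub>2 = B\<^sub>2 \<circ> \<sigma>"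
    using assms(1) by (auto simp: jointly_unitarily_equivalent_def ABC)
  obtain \<tau> where \<tau>: "unitary_op \<tau>" "\<tau> \<circ> B\<^sub>1 = C\<^sub>1 \<circ> \<tau>" "\<tau> \<circ> B\<^sub>2 = C\<^sub>2 \<circ> \<tau>"
    using assms(2) by (auto simp: jointly_unitarily_equivalent_def ABC)
  have "(\<tau> \<circ> \<sigma>) \<circ> A\<^sub>1 = C\<^sub>1 \<circ> (\<tau> \<circ> \<sigma>)" "(\<tau> \<circ> \<sigma>) \<circ> A\<^sub>2 = C\<^sub>2 \<circ> (\<tau> \<circ> \<sigma>)"
    using \<sigma> \<tau> by (simp_all add: fun_eq_iff)
  then show ?thesis
    using unitary_op_compose[OF \<tau>(1) \<sigma>(1)]
    unfolding jointly_unitarily_equivalent_def ABC prod.case by blast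
qed

text \<open>Lets the given pairs of isometries be replaced by their models, so that only equivalence
  of two model pairs remains to be decided.\<close>

lemma jointly_unitarily_equivalent_cong:
  assumes "jointly_unitarily_equivalent A B" "jointly_unitarily_equivalent A' B'"
  shows "jointly_unitarily_equivalent A A' \<longleftrightarrow> jointly_unitarily_equivalent B B'"
  by (metis assms jointly_unitarily_equivalent_sym jointly_unitarily_equivalent_trans)


section \<open>Coefficients of operators on vector-valued Hardy spaces\<close>

lemma bounded_clinear_hardy_coeff: "bounded_clinear (\<lambda>f. hardy_coeff f n)"
  by (rule bounded_clinearI[where K = 1]) (auto simp: norm_hardy_coeff_le)

lemma bounded_clinear_scaleC_op: "bounded_clinear (\<lambda>x. c *\<^sub>C x)"
  by (rule bounded_clinearI[where K = "cmod c"])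
     (auto simp: scaleC_add_right scaleC_scaleC norm_scaleC mult_ac)

text \<open>Both sides are bounded operators in \<open>g\<close>, so it suffices to compare them on
  elementary tensors, where the hypothesis on scalar coefficients applies. Every tensor operator
  below acts on coefficients like a weighted shift and is computed through this rule.\<close>

lemma hardy_coeff_tensor_op:
  assumes A: "bounded_clinear A" and B: "bounded_clinear B"
    and coeff: "\<And>f. hardy_coeff (A f) n = c * hardy_coeff f m"
  shows "hardy_coeff ((A \<otimes> B) g) n = c *\<^sub>C B (hardy_coeff g m)"
proof -
  have "(\<lambda>h. hardy_coeff h n) \<circ> (A \<otimes> B) = (\<lambda>x. c *\<^sub>C x) \<circ> (B \<circ> (\<lambda>h. hardy_coeff h m))"
  proof (rule bounded_clinear_eq_on_tensors)
    show "bounded_clinear ((\<lambda>h. hardy_coeff h n) \<circ> (A \<otimes> B))"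
      by (intro bounded_clinear_compose bounded_clinear_hardy_coeff tensor_op_works A B)
    show "bounded_clinear ((\<lambda>x. c *\<^sub>C x) \<circ> (B \<circ> (\<lambda>h. hardy_coeff h m)))"
      by (intro bounded_clinear_compose bounded_clinear_hardy_coeff bounded_clinear_scaleC_op B)
  qed (simp add: tensor_op_works[OF A B] coeff bounded_clinear_scaleC[OF B] scaleC_scaleC)
  then show ?thesis
    by (simp add: fun_eq_iff)
qed

text \<open>Only the term of index \<open>n\<close> in the series of the inner product survives.
  Pairing with the vectors \<open>z^n y\<close> therefore tests a single coefficient.\<close>

lemma cinner_monom_tensor: "cinner f (hardy_monom n \<otimes>\<^sub>H y) = cinner (hardy_coeff f n) y"
proof (rule sums_unique2[OF cinner_hardy_sums])
  have "(\<lambda>k. if k = n then cinner (hardy_coeff f k) y else 0) sums cinner (hardy_coeff f n) y"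
    by (rule sums_single)
  moreover have "(\<lambda>k. if k = n then cinner (hardy_coeff f k) y else 0)
      = (\<lambda>k. cinner (hardy_coeff f k) (hardy_coeff (hardy_monom n \<otimes>\<^sub>H y) k))"
    by auto
  ultimately show "(\<lambda>k. cinner (hardy_coeff f k) (hardy_coeff (hardy_monom n \<otimes>\<^sub>H y) k))
      sums cinner (hardy_coeff f n) y"
    by simp
qed

section \<open>The shift and its wandering subspace, the constants\<close>

definition hardy_const :: "'a::complex_hilbert \<Rightarrow> 'a hardy"
  where "hardy_const x = hardy_monom 0 \<otimes>\<^sub>H x"

lemma hardy_coeff_const [simp]: "hardy_coeff (hardy_const x) n = (if n = 0 then x else 0)"
  by (simp add: hardy_const_def)

lemma hardy_const_add: "hardy_const (x + y) = hardy_const x + hardy_const y"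
  by (simp add: hardy_const_def tensor_add_right)

lemma hardy_const_scaleC: "hardy_const (c *\<^sub>C x) = c *\<^sub>C hardy_const x"
  by (simp add: hardy_const_def tensor_scaleC_right)

lemma norm_hardy_const: "norm (hardy_const x) = norm x"
proof -
  have "cinner (hardy_const x) (hardy_const x) = cinner x x"
    using cinner_monom_tensor[of "hardy_const x" 0 x] by (simp add: hardy_const_def)
  then have "complex_of_real ((norm (hardy_const x))\<^sup>2) = complex_of_real ((norm x)\<^sup>2)"
    by (simp only: cinner_self)
  then have "(norm (hardy_const x))\<^sup>2 = (norm x)\<^sup>2"
    using of_real_eq_iff by blast
  then show ?thesis
    by (simp add: power2_eq_iff_nonneg)
qed

definition hardy_shift :: "'a::complex_hilbert hardy \<Rightarrow> 'a hardy"
  where "hardy_shift = M\<^sub>z \<otimes> id"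

lemma hardy_coeff_shift:
  "hardy_coeff (hardy_shift f) n = (if n = 0 then 0 else hardy_coeff f (n - 1))"
proof -
  \<comment> \<open>The weight 0 at \<open>n = 0\<close> absorbs the truncated index
    \<open>n - 1 = 0\<close>.\<close>
  have "hardy_coeff (hardy_shift f) n = (if n = 0 then 0 else 1) *\<^sub>C id (hardy_coeff f (n - 1))"
    unfolding hardy_shift_def
    by (rule hardy_coeff_tensor_op)
       (auto simp: hardy_coeff_mult_z bounded_clinear_id isometry_op_mult_z
         isometry_op_bounded_clinear)
  then show ?thesis
    by simp
qed

lemma hardy_shift_0: "hardy_shift 0 = 0"
  by (rule hardy_coeff_eqI) (simp add: hardy_coeff_shift)

lemma hardy_shift_monom_tensor: "hardy_shift (hardy_monom n \<otimes>\<^sub>H y) = hardy_monom (Suc n) \<otimes>\<^sub>H y"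
  by (rule hardy_coeff_eqI) (auto simp: hardy_coeff_shift)

lemma cinner_const_shift: "cinner (hardy_const x) (hardy_shift f) = 0"
  by (subst cinner_commute)
     (simp add: hardy_const_def cinner_monom_tensor hardy_coeff_shift)

text \<open>The operator applies \<open>\<omega>\<close> to each coefficient, which preserves the
  sum of the squared norms; applying \<open>inv \<omega>\<close> to each coefficient gives a right
  inverse.\<close>

lemma unitary_op_tensor_id:
  assumes \<omega>: "unitary_op \<omega>"
  shows "unitary_op (id \<otimes> \<omega>)" and "hardy_coeff ((id \<otimes> \<omega>) f) n = \<omega> (hardy_coeff f n)"
proof -
  \<comment> \<open>Stated for arbitrary types because it is also applied to
    \<open>inv \<omega>\<close>, which runs in the opposite direction.\<close>
  have coeff: "hardy_coeff ((id \<otimes> \<sigma>) g) n = \<sigma> (hardy_coeff g n)"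
    if "unitary_op \<sigma>" for n g and \<sigma> :: "'c::complex_hilbert \<Rightarrow> 'd::complex_hilbert"
    using hardy_coeff_tensor_op[OF bounded_clinear_id unitary_op_bounded_clinear[OF that],
        of n 1 n g] by simp
  show "hardy_coeff ((id \<otimes> \<omega>) f) n = \<omega> (hardy_coeff f n)"
    by (rule coeff[OF \<omega>])
  have "norm ((id \<otimes> \<omega>) g) = norm g" for g
  proof -
    have "norm (\<omega> x) = norm x" for x
      using \<omega> by (simp add: unitary_op_def isometry_op_def)
    then have "(norm ((id \<otimes> \<omega>) g))\<^sup>2 = (norm g)\<^sup>2"
      using norm_hardy_sums[of "(id \<otimes> \<omega>) g"] norm_hardy_sums[of g]
      by (simp add: coeff[OF \<omega>] sums_unique2)
    then show ?thesis
      by (simp add: power2_eq_iff_nonneg)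
  qed
  moreover have "(id \<otimes> \<omega>) ((id \<otimes> inv \<omega>) g) = g" for g
    by (rule hardy_coeff_eqI)
       (simp add: coeff[OF \<omega>] coeff[OF unitary_op_inv[OF \<omega>]] unitary_op_inv_simps[OF \<omega>])
  then have "surj (id \<otimes> \<omega>)"
    by (metis surjI)
  ultimately show "unitary_op (id \<otimes> \<omega>)"
    using tensor_op_works(1)[OF bounded_clinear_id unitary_op_bounded_clinear[OF \<omega>]]
    by (simp add: unitary_op_def isometry_op_def)
qed

lemma unitary_op_dsum:
  assumes S: "unitary_op S" and T: "unitary_op T"
  shows "unitary_op (S \<oplus>\<^sub>H T)"
proof -
  have "isometry_op (S \<oplus>\<^sub>H T)"
    using S T
    by (intro isometry_opI)
       (auto simp: op_dsum_def scaleC_prod_def norm_prod_def unitary_op_def isometry_op_def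
         bounded_clinear_add bounded_clinear_scaleC)
  then show ?thesis
    using S T by (simp add: unitary_op_def op_dsum_def prod.map_id0 map_prod_surj)
qed


section \<open>Intertwining operators between shifts plus unitaries\<close>

text \<open>
  If \<open>W\<close> is surjective then each \<open>(0, k)\<close> has a preimage \<open>(0, k')\<close> under \<open>hardy_shift \<oplus>\<^sub>H W\<close>, so its
  image lies in the range of all powers of \<open>hardy_shift \<oplus>\<^sub>H W'\<close>.
\<close>

lemma intertwine_unitary_part:
  fixes \<tau> :: "'f::complex_hilbert hardy \<times> 'k::complex_hilbert
    \<Rightarrow> 'g::complex_hilbert hardy \<times> 'l::complex_hilbert"
  assumes \<tau>: "\<And>x. \<tau> ((hardy_shift \<oplus>\<^sub>H W) x) = (hardy_shift \<oplus>\<^sub>H W') (\<tau> x)"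
    and W: "surj W"
  shows "fst (\<tau> (0, k)) = 0"
proof -
  have "hardy_coeff (fst (\<tau> (0, k))) n = 0" for n k
  proof (induction n arbitrary: k)
    case (0 k)
    obtain k' where "k = W k'"
      using W by (metis surjD)
    then show ?case
      using \<tau>[of "(0, k')"] by (simp add: op_dsum_def hardy_shift_0 hardy_coeff_shift)
  next
    case (Suc n k)
    obtain k' where "k = W k'"
      using W by (metis surjD)
    then show ?case
      using \<tau>[of "(0, k')"] Suc.IH[of k']
      by (simp add: op_dsum_def hardy_shift_0 hardy_coeff_shift)
  qed
  then show ?thesis
    by (intro hardy_coeff_eqI) simp
qed

text \<open>The hypotheses are symmetric in the two sides, so \<open>inv \<tau>\<close> satisfies
  them as well and each result about \<open>\<tau>\<close> has a counterpart for its
  inverse.\<close>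

locale shift_intertwiner =
  fixes \<tau> :: "'f::complex_hilbert hardy \<times> 'k::complex_hilbert
      \<Rightarrow> 'g::complex_hilbert hardy \<times> 'l::complex_hilbert"
    and W :: "'k \<Rightarrow> 'k" and W' :: "'l \<Rightarrow> 'l"
  assumes \<tau>: "unitary_op \<tau>"
    and W: "unitary_op W" and W': "unitary_op W'"
    and shift: "\<tau> ((hardy_shift \<oplus>\<^sub>H W) x) = (hardy_shift \<oplus>\<^sub>H W') (\<tau> x)"
begin

section \<open>The intertwiner respects the shift summand and the unitary summand\<close>

lemma shift_intertwiner_inv: "shift_intertwiner (inv \<tau>) W' W"
proof
  show "inv \<tau> ((hardy_shift \<oplus>\<^sub>H W') x) = (hardy_shift \<oplus>\<^sub>H W) (inv \<tau> x)" for x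
    by (metis shift unitary_op_inv_simps[OF \<tau>])
qed (use W W' unitary_op_inv[OF \<tau>] in auto)

lemma fst_unitary_part: "fst (\<tau> (0, k)) = 0"
  using W by (intro intertwine_unitary_part[where W = W and W' = W'] shift) (simp add: unitary_op_def)

lemma fst_inv_unitary_part: "fst (inv \<tau> (0, k)) = 0"
  by (rule shift_intertwiner.fst_unitary_part[OF shift_intertwiner_inv])

lemma cinner_inv: "cinner (\<tau> x) y = cinner x (inv \<tau> y)"
  by (metis \<tau> isometry_op_cinner unitary_op_def unitary_op_inv_simps(1))

text \<open>The adjoint of \<open>\<tau>\<close> is \<open>inv \<tau>\<close>, which maps the
  unitary summand into the unitary summand; hence \<open>\<tau>\<close> maps the orthogonal
  complement, the shift summand, into the orthogonal complement.\<close>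

lemma snd_shift_part: "snd (\<tau> (f, 0)) = 0"
proof (rule cinner_left_eqI)
  fix k
  have "cinner (snd (\<tau> (f, 0))) k = cinner (\<tau> (f, 0)) (0, k)"
    by (simp add: cinner_prod_def)
  also have "\<dots> = cinner (f, 0) (inv \<tau> (0, k))"
    by (rule cinner_inv)
  finally show "cinner (snd (\<tau> (f, 0))) k = cinner 0 k"
    by (simp add: cinner_prod_def fst_inv_unitary_part)
qed

text \<open>This will be the unitary \<open>\<omega>\<close>. Reading off only the coefficient of
  degree 0 loses nothing, since constants turn out to be mapped to constants.\<close>

definition const_part :: "'f \<Rightarrow> 'g"
  where "const_part x = hardy_coeff (fst (\<tau> (hardy_const x, 0))) 0"

definition unitary_part :: "'k \<Rightarrow> 'l"
  where "unitary_part k = snd (\<tau> (0, k))"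

lemma unitary_part: "\<tau> (0, k) = (0, unitary_part k)"
  by (simp add: prod_eq_iff unitary_part_def fst_unitary_part)

text \<open>The constants are the orthogonal complement of the range of the shift.\<close>

lemma const_part: "\<tau> (hardy_const x, 0) = (hardy_const (const_part x), 0)"
proof -
  define g where "g = fst (\<tau> (hardy_const x, 0))"
  have g: "\<tau> (hardy_const x, 0) = (g, 0)"
    by (simp add: prod_eq_iff g_def snd_shift_part)
  have "cinner g (hardy_shift h) = 0" for h
  proof -
    interpret inv: shift_intertwiner "inv \<tau>" W' W
      by (rule shift_intertwiner_inv)
    have "cinner g (hardy_shift h) = cinner (\<tau> (hardy_const x, 0)) ((hardy_shift \<oplus>\<^sub>H W') (h, 0))"
      by (simp add: g cinner_prod_def op_dsum_def)
    \<comment> \<open>Moving \<open>\<tau>\<close> to the other side and commuting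
      \<open>inv \<tau>\<close> with the shift puts the Hardy component of the second vector into
      the range of the shift, which is orthogonal to constants.\<close>
    also have "\<dots> = cinner (hardy_const x, 0) ((hardy_shift \<oplus>\<^sub>H W) (inv \<tau> (h, 0)))"
      by (simp only: cinner_inv inv.shift)
    finally show ?thesis
      by (simp add: cinner_prod_def op_dsum_def cinner_const_shift)
  qed
  \<comment> \<open>Take \<open>h = z^n y\<close>, whose shift \<open>z^(n+1) y\<close> tests the
    coefficient of degree \<open>n + 1\<close>.\<close>
  then have "cinner (hardy_coeff g (Suc n)) y = cinner 0 y" for n y
    by (simp flip: cinner_monom_tensor hardy_shift_monom_tensor)
  then have "hardy_coeff g (Suc n) = 0" for n
    by (rule cinner_left_eqI)
  then have "g = hardy_const (const_part x)"
    by (intro hardy_coeff_eqI) (auto simp: const_part_def g_def gr0_conv_Suc)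
  then show ?thesis
    by (simp add: g)
qed

text \<open>Supplies surjectivity of \<open>const_part\<close>: the constant part of
  \<open>inv \<tau>\<close> is a right inverse.\<close>

lemma const_part_inv: "const_part (shift_intertwiner.const_part (inv \<tau>) y) = y"
proof -
  interpret inv: shift_intertwiner "inv \<tau>" W' W
    by (rule shift_intertwiner_inv)
  have "\<tau> (inv \<tau> (hardy_const y, 0)) = (hardy_const (const_part (inv.const_part y)), 0)"
    by (simp add: inv.const_part const_part)
  then have "hardy_coeff (hardy_const y) 0
      = hardy_coeff (hardy_const (const_part (inv.const_part y))) 0"
    by (simp only: unitary_op_inv_simps(1)[OF \<tau>] prod.inject)
  then show ?thesis
    by simp
qed

lemma unitary_part_inv: "unitary_part (shift_intertwiner.unitary_part (inv \<tau>) y) = y"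
proof -
  interpret inv: shift_intertwiner "inv \<tau>" W' W
    by (rule shift_intertwiner_inv)
  have "\<tau> (inv \<tau> (0, y)) = (0, unitary_part (inv.unitary_part y))"
    by (simp add: inv.unitary_part unitary_part)
  then show ?thesis
    by (simp add: unitary_op_inv_simps(1)[OF \<tau>])
qed

section \<open>The restrictions to the constants and to the unitary summand are unitary\<close>

lemma unitary_op_const_part: "unitary_op const_part"
  unfolding unitary_op_def
proof
  note bc = unitary_op_bounded_clinear[OF \<tau>]
  show "isometry_op const_part"
  proof (rule isometry_opI)
    show "const_part (x + y) = const_part x + const_part y" for x y
      using bounded_clinear_add[OF bc, of "(hardy_const x, 0)" "(hardy_const y, 0)"]
      by (simp add: const_part_def hardy_const_add)
    show "const_part (c *\<^sub>C x) = c *\<^sub>C const_part x" for c x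
      using bounded_clinear_scaleC[OF bc, of c "(hardy_const x, 0)"]
      by (simp add: const_part_def hardy_const_scaleC scaleC_prod_def)
    show "norm (const_part x) = norm x" for x
    proof -
      have "norm (\<tau> (hardy_const x, 0)) = norm (hardy_const x, 0 :: 'k)"
        using \<tau> by (simp add: unitary_op_def isometry_op_def)
      then show ?thesis
        by (simp add: const_part norm_prod_def norm_hardy_const)
    qed
  qed
  show "surj const_part"
    using const_part_inv by (metis surjI)
qed

lemma unitary_op_unitary_part: "unitary_op unitary_part"
  unfolding unitary_op_def
proof
  note bc = unitary_op_bounded_clinear[OF \<tau>]
  show "isometry_op unitary_part"
  proof (rule isometry_opI)
    show "unitary_part (x + y) = unitary_part x + unitary_part y" for x y
      using bounded_clinear_add[OF bc, of "(0, x)" "(0, y)"] by (simp add: unitary_part_def)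
    show "unitary_part (c *\<^sub>C x) = c *\<^sub>C unitary_part x" for c x
      using bounded_clinear_scaleC[OF bc, of c "(0, x)"]
      by (simp add: unitary_part_def scaleC_prod_def)
    show "norm (unitary_part x) = norm x" for x
    proof -
      have "norm (\<tau> (0, x)) = norm (0 :: 'f hardy, x)"
        using \<tau> by (simp add: unitary_op_def isometry_op_def)
      then show ?thesis
        by (simp add: unitary_part norm_prod_def)
    qed
  qed
  show "surj unitary_part"
    using unitary_part_inv by (metis surjI)
qed

text \<open>The model operators send constants to polynomials of degree at most one. On these
  \<open>\<tau>\<close> acts by \<open>const_part\<close> on both coefficients, the one of degree
  one being reached by commuting \<open>\<tau>\<close> with the shift.\<close>

lemma polynomial_part:
  "\<tau> (hardy_const x + hardy_shift (hardy_const y), 0)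
    = (hardy_const (const_part x) + hardy_shift (hardy_const (const_part y)), 0)"
proof -
  have 0: "W 0 = 0" "W' 0 = 0"
    using W W' by (auto intro: bounded_clinear_0 unitary_op_bounded_clinear)
  have "\<tau> (hardy_shift (hardy_const y), 0) = (hardy_shift (hardy_const (const_part y)), 0)"
    using shift[of "(hardy_const y, 0)"] by (simp add: op_dsum_def const_part 0)
  then show ?thesis
    using bounded_clinear_add[OF unitary_op_bounded_clinear[OF \<tau>],
        of "(hardy_const x, 0)" "(hardy_shift (hardy_const y), 0)"]
    by (simp add: const_part)
qed

text \<open>Comparing the coefficients of degree 0 and 1 splits one equation on the Hardy space into
  two on the coefficient space.\<close>

lemma polynomial_part_eqD:
  assumes "\<tau> (hardy_const x + hardy_shift (hardy_const y), 0)
    = (hardy_const x' + hardy_shift (hardy_const y'), 0)"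
  shows "const_part x = x'" "const_part y = y'"
proof -
  have eq: "hardy_const (const_part x) + hardy_shift (hardy_const (const_part y))
      = hardy_const x' + hardy_shift (hardy_const y')"
    using assms by (simp add: polynomial_part)
  show "const_part x = x'" "const_part y = y'"
    using arg_cong[OF eq, of "\<lambda>f. hardy_coeff f 0"] arg_cong[OF eq, of "\<lambda>f. hardy_coeff f 1"]
    by (simp_all add: hardy_coeff_shift)
qed

end


section \<open>The common form of the two models\<close>

text \<open>In the composite of the two model operators, \<open>A \<circ> C\<close>,
  \<open>A \<circ> D + B \<circ> C\<close> and \<open>B \<circ> D\<close> multiply the shifts of
  degree 0, 1 and 2. The relations leave exactly the shift of degree 1.\<close>

definition shift_factors ::
    "('f::complex_hilbert \<Rightarrow> 'f) \<Rightarrow> ('f \<Rightarrow> 'f) \<Rightarrow> ('f \<Rightarrow> 'f) \<Rightarrow> ('f \<Rightarrow> 'f) \<Rightarrow> bool"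
  where "shift_factors A B C D \<longleftrightarrow>
    bounded_clinear A \<and> bounded_clinear B \<and> bounded_clinear C \<and> bounded_clinear D \<and>
    (\<forall>x. A (C x) = 0) \<and> (\<forall>x. B (D x) = 0) \<and> (\<forall>x. A (D x) + B (C x) = x)"

definition model_fst ::
    "complex \<Rightarrow> ('f::complex_hilbert \<Rightarrow> 'f) \<Rightarrow> ('f \<Rightarrow> 'f) \<Rightarrow> 'f hardy \<Rightarrow> 'f hardy"
  where "model_fst q A B = R\<^bsub>q\<^esub> \<otimes> A \<boxplus> (M\<^sub>z \<circ> R\<^bsub>q\<^esub>) \<otimes> B"

definition model_snd ::
    "complex \<Rightarrow> ('f::complex_hilbert \<Rightarrow> 'f) \<Rightarrow> ('f \<Rightarrow> 'f) \<Rightarrow> 'f hardy \<Rightarrow> 'f hardy"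
  where "model_snd q C D = R\<^bsub>cnj q\<^esub> \<otimes> C \<boxplus> (R\<^bsub>cnj q\<^esub> \<circ> M\<^sub>z) \<otimes> D"

context
  fixes q :: complex
  assumes q: "cmod q = 1"
begin

lemma cnj_power_mult: "q ^ n * cnj q ^ n = 1"
  using q by (simp add: complex_norm_square[symmetric] flip: power_mult_distrib)

lemma bounded_clinear_rotation: "bounded_clinear R\<^bsub>q\<^esub>" "bounded_clinear R\<^bsub>cnj q\<^esub>"
  using q by (simp_all add: isometry_op_rotation isometry_op_bounded_clinear)

lemma hardy_coeff_model_fst:
  assumes "bounded_clinear A" "bounded_clinear B"
  shows "hardy_coeff (model_fst q A B f) n = q ^ n *\<^sub>C A (hardy_coeff f n)
    + (if n = 0 then 0 else q ^ (n - 1) *\<^sub>C B (hardy_coeff f (n - 1)))"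
proof -
  have "hardy_coeff ((R\<^bsub>q\<^esub> \<otimes> A) f) n = q ^ n *\<^sub>C A (hardy_coeff f n)"
    by (rule hardy_coeff_tensor_op) (simp_all add: assms bounded_clinear_rotation hardy_coeff_rotation q)
  \<comment> \<open>The rotation acts before multiplication by \<open>z\<close>, so the exponent is
    \<open>n - 1\<close>.\<close>
  moreover have "hardy_coeff (((M\<^sub>z \<circ> R\<^bsub>q\<^esub>) \<otimes> B) f) n
      = (if n = 0 then 0 else q ^ (n - 1)) *\<^sub>C B (hardy_coeff f (n - 1))"
    by (rule hardy_coeff_tensor_op)
       (simp_all add: assms bounded_clinear_rotation bounded_clinear_compose
         isometry_op_mult_z isometry_op_bounded_clinear hardy_coeff_rotation hardy_coeff_mult_z q)
  ultimately show ?thesis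
    by (simp add: model_fst_def op_plus_def)
qed

lemma hardy_coeff_model_snd:
  assumes "bounded_clinear C" "bounded_clinear D"
  shows "hardy_coeff (model_snd q C D f) n = cnj q ^ n *\<^sub>C C (hardy_coeff f n)
    + (if n = 0 then 0 else cnj q ^ n *\<^sub>C D (hardy_coeff f (n - 1)))"
proof -
  have "hardy_coeff ((R\<^bsub>cnj q\<^esub> \<otimes> C) f) n = cnj q ^ n *\<^sub>C C (hardy_coeff f n)"
    by (rule hardy_coeff_tensor_op) (simp_all add: assms bounded_clinear_rotation hardy_coeff_rotation q)
  \<comment> \<open>Here the rotation acts after multiplication by \<open>z\<close>, so the exponent
    is \<open>n\<close>.\<close>
  moreover have "hardy_coeff (((R\<^bsub>cnj q\<^esub> \<circ> M\<^sub>z) \<otimes> D) f) n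
      = (if n = 0 then 0 else cnj q ^ n) *\<^sub>C D (hardy_coeff f (n - 1))"
    by (rule hardy_coeff_tensor_op)
       (simp_all add: assms bounded_clinear_rotation bounded_clinear_compose
         isometry_op_mult_z isometry_op_bounded_clinear hardy_coeff_rotation hardy_coeff_mult_z q)
  ultimately show ?thesis
    by (simp add: model_snd_def op_plus_def)
qed

text \<open>Both terms of \<open>model_snd\<close> carry the weight \<open>cnj q ^ n\<close> in
  degree \<open>n\<close>. It cancels against \<open>q ^ n\<close> in front of \<open>A\<close>, and
  likewise in degree \<open>n - 1\<close> in front of \<open>B\<close>, so no power of
  \<open>q\<close> is left.\<close>

lemma model_fst_snd:
  assumes "shift_factors A B C D"
  shows "model_fst q A B (model_snd q C D f) = hardy_shift f"
proof (rule hardy_coeff_eqI)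
  fix n
  have bc: "bounded_clinear A" "bounded_clinear B" "bounded_clinear C" "bounded_clinear D"
    and alg: "\<And>x. A (C x) = 0" "\<And>x. B (D x) = 0" "\<And>x. A (D x) + B (C x) = x"
    using assms by (auto simp: shift_factors_def)
  show "hardy_coeff (model_fst q A B (model_snd q C D f)) n = hardy_coeff (hardy_shift f) n"
    using alg(3)[of "hardy_coeff f (n - 1)"]
    \<comment> \<open>The term with the coefficient of index \<open>n - 2\<close> is present only
      from degree 2 on.\<close>
    by (cases "n \<le> 1") (auto simp: hardy_coeff_model_fst hardy_coeff_model_snd bc hardy_coeff_shift alg(1,2)
        bounded_clinear_add[OF bc(1)] bounded_clinear_add[OF bc(2)]
        bounded_clinear_scaleC[OF bc(1)] bounded_clinear_scaleC[OF bc(2)]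
        bounded_clinear_0[OF bc(1)] bounded_clinear_0[OF bc(2)] scaleC_scaleC cnj_power_mult)
qed

lemma model_fst_const:
  assumes "bounded_clinear A" "bounded_clinear B"
  shows "model_fst q A B (hardy_const x) = hardy_const (A x) + hardy_shift (hardy_const (B x))"
  by (rule hardy_coeff_eqI)
     (use assms in \<open>auto simp: hardy_coeff_model_fst hardy_coeff_shift bounded_clinear_0\<close>)

text \<open>The factor \<open>cnj q\<close> arises because the rotation follows multiplication by
  \<open>z\<close>; in \<open>model_fst\<close> it precedes it and fixes constants.\<close>

lemma model_snd_const:
  assumes "bounded_clinear C" "bounded_clinear D"
  shows "model_snd q C D (hardy_const x)
    = hardy_const (C x) + hardy_shift (hardy_const (cnj q *\<^sub>C D x))"
proof (rule hardy_coeff_eqI)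
  fix n :: nat
  consider "n = 0" | "n = 1" | "n \<ge> 2"
    by linarith
  then show "hardy_coeff (model_snd q C D (hardy_const x)) n
      = hardy_coeff (hardy_const (C x) + hardy_shift (hardy_const (cnj q *\<^sub>C D x))) n"
    by cases (use assms in \<open>auto simp: hardy_coeff_model_snd hardy_coeff_shift bounded_clinear_0\<close>)
qed

text \<open>Forward, \<open>\<omega>\<close> and \<open>\<omega>\<^sub>u\<close> are the
  restrictions \<open>const_part\<close> and \<open>unitary_part\<close> of the given
  \<open>\<tau>\<close>. Conversely,
  \<open>(id \<otimes> \<omega>) \<oplus>\<^sub>H \<omega>\<^sub>u\<close> intertwines the two
  pairs.\<close>

lemma model_equivalent_iff:
  fixes A B C D :: "'f::complex_hilbert \<Rightarrow> 'f" and W\<^sub>1 W\<^sub>2 :: "'k::complex_hilbert \<Rightarrow> 'k"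
    and A' B' C' D' :: "'g::complex_hilbert \<Rightarrow> 'g" and W\<^sub>1' W\<^sub>2' :: "'l::complex_hilbert \<Rightarrow> 'l"
  assumes factors: "shift_factors A B C D" and factors': "shift_factors A' B' C' D'"
    and W: "unitary_op W\<^sub>1" "unitary_op W\<^sub>2" and W': "unitary_op W\<^sub>1'" "unitary_op W\<^sub>2'"
  shows "jointly_unitarily_equivalent
      (model_fst q A B \<oplus>\<^sub>H W\<^sub>1, model_snd q C D \<oplus>\<^sub>H W\<^sub>2)
      (model_fst q A' B' \<oplus>\<^sub>H W\<^sub>1', model_snd q C' D' \<oplus>\<^sub>H W\<^sub>2') \<longleftrightarrow>
    (\<exists>(\<omega> :: 'f \<Rightarrow> 'g) (\<omega>\<^sub>u :: 'k \<Rightarrow> 'l). unitary_op \<omega> \<and> unitary_op \<omega>\<^sub>u \<and>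
      (\<omega> \<circ> A = A' \<circ> \<omega> \<and> \<omega> \<circ> B = B' \<circ> \<omega> \<and> \<omega> \<circ> C = C' \<circ> \<omega> \<and> \<omega> \<circ> D = D' \<circ> \<omega>) \<and>
      \<omega>\<^sub>u \<circ> W\<^sub>1 = W\<^sub>1' \<circ> \<omega>\<^sub>u \<and> \<omega>\<^sub>u \<circ> W\<^sub>2 = W\<^sub>2' \<circ> \<omega>\<^sub>u)"
    (is "jointly_unitarily_equivalent (?T\<^sub>1, ?T\<^sub>2) (?T\<^sub>1', ?T\<^sub>2') \<longleftrightarrow> ?R")
proof
  have bc: "bounded_clinear A" "bounded_clinear B" "bounded_clinear C" "bounded_clinear D"
    and bc': "bounded_clinear A'" "bounded_clinear B'" "bounded_clinear C'" "bounded_clinear D'"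
    using factors factors' by (auto simp: shift_factors_def)
  {
    assume "jointly_unitarily_equivalent (?T\<^sub>1, ?T\<^sub>2) (?T\<^sub>1', ?T\<^sub>2')"
    then obtain \<tau> where \<tau>: "unitary_op \<tau>"
      and "\<tau> \<circ> ?T\<^sub>1 = ?T\<^sub>1' \<circ> \<tau>" "\<tau> \<circ> ?T\<^sub>2 = ?T\<^sub>2' \<circ> \<tau>"
      by (auto simp: jointly_unitarily_equivalent_def)
    then have \<tau>1: "\<tau> (?T\<^sub>1 x) = ?T\<^sub>1' (\<tau> x)" and \<tau>2: "\<tau> (?T\<^sub>2 x) = ?T\<^sub>2' (\<tau> x)" for x
      by (simp_all add: fun_eq_iff del: split_paired_All)
    have prod: "?T\<^sub>1 \<circ> ?T\<^sub>2 = hardy_shift \<oplus>\<^sub>H (W\<^sub>1 \<circ> W\<^sub>2)"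
      "?T\<^sub>1' \<circ> ?T\<^sub>2' = hardy_shift \<oplus>\<^sub>H (W\<^sub>1' \<circ> W\<^sub>2')"
      by (auto simp: op_dsum_def model_fst_snd[OF factors] model_fst_snd[OF factors'])
    have 0: "W\<^sub>1 0 = 0" "W\<^sub>1' 0 = 0" "W\<^sub>2 0 = 0" "W\<^sub>2' 0 = 0"
      using W W' by (auto intro: bounded_clinear_0 unitary_op_bounded_clinear)
    \<comment> \<open>An operator intertwining both components of the pairs intertwines their
      products, which are a shift plus a unitary.\<close>
    interpret shift_intertwiner \<tau> "W\<^sub>1 \<circ> W\<^sub>2" "W\<^sub>1' \<circ> W\<^sub>2'"
      by unfold_locales
         (auto simp: \<tau>1 \<tau>2 simp del: map_prod_simp simp flip: prod intro: \<tau> unitary_op_compose W W')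
    have "const_part (A x) = A' (const_part x) \<and> const_part (B x) = B' (const_part x)" for x
      using polynomial_part_eqD[of "A x" "B x" "A' (const_part x)" "B' (const_part x)"]
        \<tau>1[of "(hardy_const x, 0)"]
      by (simp add: op_dsum_def const_part model_fst_const bc bc' 0)
    moreover have "const_part (C x) = C' (const_part x) \<and> const_part (D x) = D' (const_part x)" for x
    proof -
      have *: "const_part (C x) = C' (const_part x)"
        "const_part (cnj q *\<^sub>C D x) = cnj q *\<^sub>C D' (const_part x)"
        using polynomial_part_eqD[of "C x" "cnj q *\<^sub>C D x" "C' (const_part x)"
            "cnj q *\<^sub>C D' (const_part x)"] \<tau>2[of "(hardy_const x, 0)"]
        by (simp_all add: op_dsum_def const_part model_snd_const bc bc' 0)
      \<comment> \<open>Multiplying by \<open>q\<close> removes \<open>cnj q\<close>, as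
        \<open>q\<close> is unimodular.\<close>
      have "q *\<^sub>C cnj q *\<^sub>C const_part (D x) = q *\<^sub>C cnj q *\<^sub>C D' (const_part x)"
        using *(2)
        by (simp add: bounded_clinear_scaleC[OF unitary_op_bounded_clinear[OF unitary_op_const_part]])
      then show ?thesis
        using *(1) cnj_power_mult[of 1] by (simp add: scaleC_scaleC)
    qed
    \<comment> \<open>On vectors \<open>(0, k)\<close> only the unitary summands act, so the
      intertwining relations reduce to those for \<open>unitary_part\<close>.\<close>
    moreover have "model_fst q A B 0 = 0" "model_snd q C D 0 = 0"
      by (rule hardy_coeff_eqI; simp add: hardy_coeff_model_fst hardy_coeff_model_snd
          bc bounded_clinear_0)+
    then have "unitary_part (W\<^sub>1 k) = W\<^sub>1' (unitary_part k)"
      "unitary_part (W\<^sub>2 k) = W\<^sub>2' (unitary_part k)" for k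
      using \<tau>1[of "(0, k)"] \<tau>2[of "(0, k)"]
      by (simp_all add: op_dsum_def unitary_part)
    ultimately show ?R
      using unitary_op_const_part unitary_op_unitary_part
      by (intro exI[of _ const_part] exI[of _ unitary_part]) (simp add: fun_eq_iff)
  }
  assume ?R
  then obtain \<omega> :: "'f \<Rightarrow> 'g" and \<omega>\<^sub>u :: "'k \<Rightarrow> 'l"
    where \<omega>: "unitary_op \<omega>" and \<omega>\<^sub>u: "unitary_op \<omega>\<^sub>u"
      and eqs: "\<And>x. \<omega> (A x) = A' (\<omega> x)" "\<And>x. \<omega> (B x) = B' (\<omega> x)"
        "\<And>x. \<omega> (C x) = C' (\<omega> x)" "\<And>x. \<omega> (D x) = D' (\<omega> x)"
        "\<And>x. \<omega>\<^sub>u (W\<^sub>1 x) = W\<^sub>1' (\<omega>\<^sub>u x)" "\<And>x. \<omega>\<^sub>u (W\<^sub>2 x) = W\<^sub>2' (\<omega>\<^sub>u x)"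
    by (auto simp: fun_eq_iff)
  note \<omega>_bc = unitary_op_bounded_clinear[OF \<omega>]
  note \<omega>_simps = unitary_op_tensor_id(2)[OF \<omega>] bounded_clinear_add[OF \<omega>_bc]
    bounded_clinear_scaleC[OF \<omega>_bc] bounded_clinear_0[OF \<omega>_bc]
  \<comment> \<open>Each coefficient is a combination of values of \<open>A\<close> and
    \<open>B\<close> with scalar weights, and \<open>\<omega>\<close> passes through all of
    these.\<close>
  have "(id \<otimes> \<omega>) (model_fst q A B f) = model_fst q A' B' ((id \<otimes> \<omega>) f)" for f
    by (rule hardy_coeff_eqI) (simp add: \<omega>_simps hardy_coeff_model_fst bc bc' eqs)
  moreover have "(id \<otimes> \<omega>) (model_snd q C D f) = model_snd q C' D' ((id \<otimes> \<omega>) f)" for f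
    by (rule hardy_coeff_eqI) (simp add: \<omega>_simps hardy_coeff_model_snd bc bc' eqs)
  moreover have "unitary_op ((id \<otimes> \<omega>) \<oplus>\<^sub>H \<omega>\<^sub>u)"
    by (intro unitary_op_dsum unitary_op_tensor_id \<omega> \<omega>\<^sub>u)
  ultimately show "jointly_unitarily_equivalent (?T\<^sub>1, ?T\<^sub>2) (?T\<^sub>1', ?T\<^sub>2')"
    unfolding jointly_unitarily_equivalent_def prod.case
    by (intro exI[of _ "(id \<otimes> \<omega>) \<oplus>\<^sub>H \<omega>\<^sub>u"]) (auto simp: op_dsum_def eqs)
qed

end


section \<open>The two kinds of tuples\<close>

lemma bounded_clinear_compl_proj:
  assumes P: "bounded_clinear P"
  shows "bounded_clinear (P\<^sup>\<bottom>)"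
proof -
  have "bounded_linear (\<lambda>x. x - P x)"
    by (intro bounded_linear_sub bounded_linear_ident bounded_clinear_bounded_linear P)
  then show ?thesis
    by (simp add: bounded_clinear_def compl_proj_def bounded_clinear_scaleC[OF P] scaleC_diff_right)
qed

context
  fixes P U :: "'f::complex_hilbert \<Rightarrow> 'f"
  assumes P: "orthogonal_projection P" and U: "unitary_op U"
begin

lemma projection_unitary_bounded_clinear:
  "bounded_clinear P" "bounded_clinear (P\<^sup>\<bottom>)" "bounded_clinear U" "bounded_clinear (U\<^sup>\<star>)"
  using P U
  by (auto simp: orthogonal_projection_def bounded_clinear_compl_proj unitary_op_bounded_clinear
      unitary_op_cadjoint unitary_op_inv)

lemma projection_simps: "P (P x) = P x" "(P\<^sup>\<bottom>) (P x) = 0" "P ((P\<^sup>\<bottom>) x) = 0" "(P\<^sup>\<bottom>) ((P\<^sup>\<bottom>) x) = (P\<^sup>\<bottom>) x"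
    "(P\<^sup>\<bottom>) x + P x = x"
proof -
  show idem: "P (P x) = P x" for x
    using P by (simp add: orthogonal_projection_def fun_eq_iff)
  show "(P\<^sup>\<bottom>) (P x) = 0" "P ((P\<^sup>\<bottom>) x) = 0" "(P\<^sup>\<bottom>) ((P\<^sup>\<bottom>) x) = (P\<^sup>\<bottom>) x" "(P\<^sup>\<bottom>) x + P x = x"
    by (simp_all add: compl_proj_def idem
        bounded_clinear_diff[OF projection_unitary_bounded_clinear(1)])
qed

lemma unitary_cadjoint_simps: "U ((U\<^sup>\<star>) x) = x" "(U\<^sup>\<star>) (U x) = x"
  by (simp_all add: unitary_op_cadjoint[OF U] unitary_op_inv_simps[OF U])

text \<open>\<open>U\<close> and its adjoint cancel in the middle of every product, leaving products
  of \<open>P\<close> and \<open>P\<^sup>\<bottom>\<close>; the mixed ones vanish and the two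
  squares add up to the identity.\<close>

lemma BCL1_shift_factors: "shift_factors (P\<^sup>\<bottom> \<circ> U) (P \<circ> U) (U\<^sup>\<star> \<circ> P) (U\<^sup>\<star> \<circ> P\<^sup>\<bottom>)"
  unfolding shift_factors_def
  by (intro conjI allI bounded_clinear_compose projection_unitary_bounded_clinear)
     (simp_all add: unitary_cadjoint_simps projection_simps)

text \<open>Now the projections meet in the middle: mixed products vanish, and the remaining sum is
  \<open>U\<^sup>\<star> \<circ> U\<close> because \<open>P\<close> and
  \<open>P\<^sup>\<bottom>\<close> add up to the identity.\<close>

lemma BCL2_shift_factors: "shift_factors (U\<^sup>\<star> \<circ> P\<^sup>\<bottom>) (U\<^sup>\<star> \<circ> P) (P \<circ> U) (P\<^sup>\<bottom> \<circ> U)"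
proof -
  note bc = projection_unitary_bounded_clinear(4)
  have "(U\<^sup>\<star>) ((P\<^sup>\<bottom>) (U x)) + (U\<^sup>\<star>) (P (U x)) = x" for x
    by (simp add: projection_simps unitary_cadjoint_simps flip: bounded_clinear_add[OF bc])
  then show ?thesis
    unfolding shift_factors_def
    by (intro conjI allI bounded_clinear_compose projection_unitary_bounded_clinear)
       (simp_all add: unitary_cadjoint_simps projection_simps bounded_clinear_0[OF bc])
qed

end

section \<open>Recovering the projection and the unitary from the coefficient operators\<close>

context
  fixes P U :: "'f::complex_hilbert \<Rightarrow> 'f" and P' U' :: "'g::complex_hilbert \<Rightarrow> 'g"
    and \<omega> :: "'f \<Rightarrow> 'g"
  assumes P: "orthogonal_projection P" and U: "unitary_op U"
    and P': "orthogonal_projection P'" and U': "unitary_op U'"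
    and \<omega>: "unitary_op \<omega>"
begin

lemma intertwine_cadjoint:
  assumes "\<omega> \<circ> U = U' \<circ> \<omega>"
  shows "\<omega> \<circ> U\<^sup>\<star> = U'\<^sup>\<star> \<circ> \<omega>"
  using intertwine_inv[OF U U', of \<omega>] assms
  by (simp add: fun_eq_iff unitary_op_cadjoint[OF U] unitary_op_cadjoint[OF U'])

lemma intertwine_compl_proj:
  assumes "\<omega> \<circ> P = P' \<circ> \<omega>"
  shows "\<omega> \<circ> P\<^sup>\<bottom> = P'\<^sup>\<bottom> \<circ> \<omega>"
  using assms
  by (simp add: fun_eq_iff compl_proj_def bounded_clinear_diff[OF unitary_op_bounded_clinear[OF \<omega>]])

text \<open>\<open>U\<close> is the sum of \<open>P\<^sup>\<bottom> \<circ> U\<close> and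
  \<open>P \<circ> U\<close>, and \<open>P\<close> is then obtained from \<open>P \<circ> U\<close>
  by composing with the inverse of \<open>U\<close>. Conversely, \<open>\<omega>\<close> also
  intertwines adjoints and complements.\<close>

lemma BCL1_intertwine_iff:
  "\<omega> \<circ> (P\<^sup>\<bottom> \<circ> U) = (P'\<^sup>\<bottom> \<circ> U') \<circ> \<omega> \<and> \<omega> \<circ> (P \<circ> U) = (P' \<circ> U') \<circ> \<omega> \<and>
    \<omega> \<circ> (U\<^sup>\<star> \<circ> P) = (U'\<^sup>\<star> \<circ> P') \<circ> \<omega> \<and> \<omega> \<circ> (U\<^sup>\<star> \<circ> P\<^sup>\<bottom>) = (U'\<^sup>\<star> \<circ> P'\<^sup>\<bottom>) \<circ> \<omega> \<longleftrightarrow>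
    \<omega> \<circ> P = P' \<circ> \<omega> \<and> \<omega> \<circ> U = U' \<circ> \<omega>" (is "?L \<longleftrightarrow> ?R")
proof
  assume L: ?L
  have U_eq: "\<omega> (U x) = U' (\<omega> x)" for x
  proof -
    have "\<omega> (U x) = \<omega> ((P\<^sup>\<bottom>) (U x) + P (U x))"
      by (simp add: projection_simps[OF P U])
    also have "\<dots> = (P'\<^sup>\<bottom>) (U' (\<omega> x)) + P' (U' (\<omega> x))"
      using L by (simp add: bounded_clinear_add[OF unitary_op_bounded_clinear[OF \<omega>]] fun_eq_iff)
    finally show ?thesis
      by (simp add: projection_simps[OF P' U'])
  qed
  have "\<omega> (P x) = P' (\<omega> x)" for x
  proof -
    have "\<omega> (P (U (inv U x))) = P' (U' (\<omega> (inv U x)))"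
      using L by (simp add: fun_eq_iff)
    then show ?thesis
      by (simp add: unitary_op_inv_simps[OF U] flip: U_eq)
  qed
  with U_eq show ?R
    by (simp add: fun_eq_iff)
next
  assume R: ?R
  then show ?L
    using intertwine_cadjoint intertwine_compl_proj by (simp add: fun_eq_iff)
qed

text \<open>The second model uses the same four operators in reverse order, so the equations are
  those of the first model rearranged.\<close>

lemma BCL2_intertwine_iff:
  "\<omega> \<circ> (U\<^sup>\<star> \<circ> P\<^sup>\<bottom>) = (U'\<^sup>\<star> \<circ> P'\<^sup>\<bottom>) \<circ> \<omega> \<and> \<omega> \<circ> (U\<^sup>\<star> \<circ> P) = (U'\<^sup>\<star> \<circ> P') \<circ> \<omega> \<and>
    \<omega> \<circ> (P \<circ> U) = (P' \<circ> U') \<circ> \<omega> \<and> \<omega> \<circ> (P\<^sup>\<bottom> \<circ> U) = (P'\<^sup>\<bottom> \<circ> U') \<circ> \<omega> \<longleftrightarrow>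
    \<omega> \<circ> P = P' \<circ> \<omega> \<and> \<omega> \<circ> U = U' \<circ> \<omega>"
  using BCL1_intertwine_iff by blast

end

section \<open>From the models back to the given pairs of isometries\<close>

lemma BCL1_equivalent_iff:
  fixes V\<^sub>1 V\<^sub>2 :: "'h::complex_hilbert \<Rightarrow> 'h" and V\<^sub>1' V\<^sub>2' :: "'h2::complex_hilbert \<Rightarrow> 'h2"
    and P U :: "'f::complex_hilbert \<Rightarrow> 'f" and P' U' :: "'f2::complex_hilbert \<Rightarrow> 'f2"
    and W\<^sub>1 W\<^sub>2 :: "'k::complex_hilbert \<Rightarrow> 'k" and W\<^sub>1' W\<^sub>2' :: "'k2::complex_hilbert \<Rightarrow> 'k2"
  assumes q: "cmod q = 1"
    and "BCL1_tuple q (V\<^sub>1, V\<^sub>2) P U W\<^sub>1 W\<^sub>2" "BCL1_tuple q (V\<^sub>1', V\<^sub>2') P' U' W\<^sub>1' W\<^sub>2'"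
  shows "jointly_unitarily_equivalent (V\<^sub>1, V\<^sub>2) (V\<^sub>1', V\<^sub>2') \<longleftrightarrow>
    (\<exists>(\<omega> :: 'f \<Rightarrow> 'f2) (\<omega>\<^sub>u :: 'k \<Rightarrow> 'k2). unitary_op \<omega> \<and> unitary_op \<omega>\<^sub>u \<and>
      \<omega> \<circ> P = P' \<circ> \<omega> \<and> \<omega> \<circ> U = U' \<circ> \<omega> \<and>
      \<omega>\<^sub>u \<circ> W\<^sub>1 = W\<^sub>1' \<circ> \<omega>\<^sub>u \<and> \<omega>\<^sub>u \<circ> W\<^sub>2 = W\<^sub>2' \<circ> \<omega>\<^sub>u)"
proof -
  have PU: "orthogonal_projection P" "unitary_op U" "orthogonal_projection P'" "unitary_op U'"
    and W: "unitary_op W\<^sub>1" "unitary_op W\<^sub>2" "unitary_op W\<^sub>1'" "unitary_op W\<^sub>2'"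
    using assms by (auto simp: BCL1_tuple_def BCL_data_def)
  \<comment> \<open>Both pairs are exchanged for their models, written in the common form;
    \<open>iff\<close> then decides equivalence of the models.\<close>
  note cong = jointly_unitarily_equivalent_cong[OF
      assms(2)[unfolded BCL1_tuple_def, THEN conjunct2]
      assms(3)[unfolded BCL1_tuple_def, THEN conjunct2], folded model_fst_def model_snd_def]
  note iff = model_equivalent_iff[OF q BCL1_shift_factors[OF PU(1,2)]
      BCL1_shift_factors[OF PU(3,4)] W]
  show ?thesis
    unfolding cong iff using BCL1_intertwine_iff[OF PU] by meson
qed

lemma BCL2_equivalent_iff:
  fixes V\<^sub>1 V\<^sub>2 :: "'h::complex_hilbert \<Rightarrow> 'h" and V\<^sub>1' V\<^sub>2' :: "'h2::complex_hilbert \<Rightarrow> 'h2"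
    and P U :: "'f::complex_hilbert \<Rightarrow> 'f" and P' U' :: "'f2::complex_hilbert \<Rightarrow> 'f2"
    and W\<^sub>1 W\<^sub>2 :: "'k::complex_hilbert \<Rightarrow> 'k" and W\<^sub>1' W\<^sub>2' :: "'k2::complex_hilbert \<Rightarrow> 'k2"
  assumes q: "cmod q = 1"
    and "BCL2_tuple q (V\<^sub>1, V\<^sub>2) P U W\<^sub>1 W\<^sub>2" "BCL2_tuple q (V\<^sub>1', V\<^sub>2') P' U' W\<^sub>1' W\<^sub>2'"
  shows "jointly_unitarily_equivalent (V\<^sub>1, V\<^sub>2) (V\<^sub>1', V\<^sub>2') \<longleftrightarrow>
    (\<exists>(\<omega> :: 'f \<Rightarrow> 'f2) (\<omega>\<^sub>u :: 'k \<Rightarrow> 'k2). unitary_op \<omega> \<and> unitary_op \<omega>\<^sub>u \<and>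
      \<omega> \<circ> P = P' \<circ> \<omega> \<and> \<omega> \<circ> U = U' \<circ> \<omega> \<and>
      \<omega>\<^sub>u \<circ> W\<^sub>1 = W\<^sub>1' \<circ> \<omega>\<^sub>u \<and> \<omega>\<^sub>u \<circ> W\<^sub>2 = W\<^sub>2' \<circ> \<omega>\<^sub>u)"
proof -
  have PU: "orthogonal_projection P" "unitary_op U" "orthogonal_projection P'" "unitary_op U'"
    and W: "unitary_op W\<^sub>1" "unitary_op W\<^sub>2" "unitary_op W\<^sub>1'" "unitary_op W\<^sub>2'"
    using assms by (auto simp: BCL2_tuple_def BCL_data_def)
  note cong = jointly_unitarily_equivalent_cong[OF
      assms(2)[unfolded BCL2_tuple_def, THEN conjunct2]
      assms(3)[unfolded BCL2_tuple_def, THEN conjunct2], folded model_fst_def model_snd_def]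
  note iff = model_equivalent_iff[OF q BCL2_shift_factors[OF PU(1,2)]
      BCL2_shift_factors[OF PU(3,4)] W]
  show ?thesis
    unfolding cong iff using BCL2_intertwine_iff[OF PU] by meson
qed

theorem theorem2p5:
  fixes q :: complex
    and V\<^sub>1 V\<^sub>2 :: "'h::complex_hilbert \<Rightarrow> 'h"
    and V\<^sub>1' V\<^sub>2' :: "'h2::complex_hilbert \<Rightarrow> 'h2"
    and P U :: "'f::complex_hilbert \<Rightarrow> 'f"
    and W\<^sub>1 W\<^sub>2 :: "'k::complex_hilbert \<Rightarrow> 'k"
    and P' U' :: "'f2::complex_hilbert \<Rightarrow> 'f2"
    and W\<^sub>1' W\<^sub>2' :: "'k2::complex_hilbert \<Rightarrow> 'k2"
    and P\<^sub>d U\<^sub>d :: "'g::complex_hilbert \<Rightarrow> 'g"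
    and W\<^sub>1\<^sub>d W\<^sub>2\<^sub>d :: "'l::complex_hilbert \<Rightarrow> 'l"
    and P\<^sub>d' U\<^sub>d' :: "'g2::complex_hilbert \<Rightarrow> 'g2"
    and W\<^sub>1\<^sub>d' W\<^sub>2\<^sub>d' :: "'l2::complex_hilbert \<Rightarrow> 'l2"
  assumes q: "cmod q = 1"
    and V: "isometry_op V\<^sub>1" "isometry_op V\<^sub>2" "q_commutative q V\<^sub>1 V\<^sub>2"
    and V': "isometry_op V\<^sub>1'" "isometry_op V\<^sub>2'" "q_commutative q V\<^sub>1' V\<^sub>2'"
  shows
    "(BCL1_tuple q (V\<^sub>1, V\<^sub>2) P U W\<^sub>1 W\<^sub>2 \<and> BCL1_tuple q (V\<^sub>1', V\<^sub>2') P' U' W\<^sub>1' W\<^sub>2' \<longrightarrow>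
       (jointly_unitarily_equivalent (V\<^sub>1, V\<^sub>2) (V\<^sub>1', V\<^sub>2') \<longleftrightarrow>
        (\<exists>(\<omega> :: 'f \<Rightarrow> 'f2) (\<omega>\<^sub>u :: 'k \<Rightarrow> 'k2). unitary_op \<omega> \<and> unitary_op \<omega>\<^sub>u \<and>
          \<omega> \<circ> P = P' \<circ> \<omega> \<and> \<omega> \<circ> U = U' \<circ> \<omega> \<and>
          \<omega>\<^sub>u \<circ> W\<^sub>1 = W\<^sub>1' \<circ> \<omega>\<^sub>u \<and> \<omega>\<^sub>u \<circ> W\<^sub>2 = W\<^sub>2' \<circ> \<omega>\<^sub>u))) \<and>
     (BCL2_tuple q (V\<^sub>1, V\<^sub>2) P\<^sub>d U\<^sub>d W\<^sub>1\<^sub>d W\<^sub>2\<^sub>d \<and> BCL2_tuple q (V\<^sub>1', V\<^sub>2') P\<^sub>d' U\<^sub>d' W\<^sub>1\<^sub>d' W\<^sub>2\<^sub>d' \<longrightarrow>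
       (jointly_unitarily_equivalent (V\<^sub>1, V\<^sub>2) (V\<^sub>1', V\<^sub>2') \<longleftrightarrow>
        (\<exists>(\<omega> :: 'g \<Rightarrow> 'g2) (\<omega>\<^sub>u :: 'l \<Rightarrow> 'l2). unitary_op \<omega> \<and> unitary_op \<omega>\<^sub>u \<and>
          \<omega> \<circ> P\<^sub>d = P\<^sub>d' \<circ> \<omega> \<and> \<omega> \<circ> U\<^sub>d = U\<^sub>d' \<circ> \<omega> \<and>
          \<omega>\<^sub>u \<circ> W\<^sub>1\<^sub>d = W\<^sub>1\<^sub>d' \<circ> \<omega>\<^sub>u \<and> \<omega>\<^sub>u \<circ> W\<^sub>2\<^sub>d = W\<^sub>2\<^sub>d' \<circ> \<omega>\<^sub>u)))"
  by (intro conjI impI; elim conjE)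
     (rule BCL1_equivalent_iff[OF q] BCL2_equivalent_iff[OF q]; assumption)+

end
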